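(* Let $\mathscr{C}=(S,V_1,V_2,\Pi_1,\Pi_2,\langle\,,\,\rangle)$ be a Coxeter datum with associated Coxeter system $(W,R)$, root systems $\Phi_1,\Phi_2$, and $W$-equivariant bijection $\phi\colon\Phi_1\to\Phi_2$. Suppose that $\Delta_1'\subseteq\Phi_1^+$ and $\Delta_2'\subseteq\Phi_2^+$ are such that (A1) $\phi(\Delta_1')=\Delta_2'$; (A2) $\langle x,\phi(x')\rangle\le 0$ for all distinct $x,x'\in\Delta_1'$; (A3) $\langle x,\phi(x')\rangle\langle x',\phi(x)\rangle\in\{\cos^2(\pi/m)\mid m\in\mathbb{N},\ m\ge 2\}\cup[1,\infty)$ for all $x,x'\in\Delta_1'$ with $r_x\ne r_{x'}$. Then $W'=\langle\{r_x\mid x\in\Delta_1'\}\rangle$ is a reflection subgroup of $W$ with $\widehat{\Delta_1'}=\widehat{\Delta_1(W')}$ and $\widehat{\Delta_2'}=\widehat{\Delta_2(W')}$.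
   Context: For a subset $A$ of a real vector space, $\mathrm{PLC}(A)$ is the set of all (finite) linear combinations $\sum_{a\in A}c_a a$ with all $c_a\ge 0$ and at least one $c_{a'}>0$. Coxeter datum: $V_1,V_2$ are real vector spaces with a bilinear pairing $\langle\,,\,\rangle\colon V_1\times V_2\to\mathbb{R}$, $S$ is an indexing set, and $\Pi_1=\{\alpha_s\mid s\in S\}\subseteq V_1$, $\Pi_2=\{\beta_s\mid s\in S\}\subseteq V_2$ are in bijection with $S$, such that: $\langle\alpha_s,\beta_s\rangle=1$ for all $s$; $0\notin\mathrm{PLC}(\Pi_i)$ for $i=1,2$, and $\alpha_s\notin\mathrm{PLC}(\Pi_1\setminus\{\alpha_s\})$, $\beta_s\notin\mathrm{PLC}(\Pi_2\setminus\{\beta_s\})$ for all $s$; for $s\ne t$, $\langle\alpha_s,\beta_t\rangle\le 0$; $\langle\alpha_s,\beta_t\rangle=0$ iff $\langle\alpha_t,\beta_s\rangle=0$; and for $s\neq t$ either $\langle\alpha_s,\beta_t\rangle\langle\alpha_t,\beta_s\rangle=\cos^2(\pi/m_{st})$ for some integer $m_{st}\ge2$, or this product is $\ge 1$ (then $m_{st}=\infty$). $(W,R)$ is the Coxeter system with $R=\{r_s\mid s\in S\}$ and $r_sr_t$ of order $m_{st}$ for $s\ne t$. $W$ acts faithfully on $V_1$ and $V_2$ with $r_sx=x-2\langle x,\beta_s\rangle\alpha_s$ ($x\in V_1$) and $r_sy=y-2\langle\alpha_s,y\rangle\beta_s$ ($y\in V_2$), and the pairing is $W$-invariant. For $i\in\{1,2\}$: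 $\Phi_i=W\Pi_i$, $\Phi_i^+=\Phi_i\cap\mathrm{PLC}(\Pi_i)$, $\Phi_i^-=-\Phi_i^+$, and $\Phi_i=\Phi_i^+\uplus\Phi_i^-$. There is a $W$-equivariant bijection $\phi\colon\Phi_1\to\Phi_2$ with $\phi(\alpha_s)=\beta_s$ for all $s\in S$. $T=\bigcup_{w\in W}wRw^{-1}$ is the set of reflections. For $x\in\Phi_1$, $x=w\alpha_s$ (resp. $x\in\Phi_2$, $x=w\beta_s$), put $r_x=wr_sw^{-1}\in T$ (well defined). A reflection subgroup of $W$ is a subgroup $W'$ with $W'=\langle W'\cap T\rangle$. For $z\in\Phi_i$, $\widehat z$ is the set of elements of $\Phi_i$ that are nonzero scalar multiples of $z$, and for $A\subseteq\Phi_i$, $\widehat A=\{\widehat z\mid z\in A\}$. $\ell\colon W\to\mathbb{N}$ is the length function of $(W,R)$; $\overline N(w)=\{t\in T\mid\ell(wt)<\ell(w)\}$ for $w\in W$. For a reflection subgroup $W'$: $S(W')=\{t\in T\mid\overline N(t)\cap W'=\{t\}\}$ and $\Delta_i(W')=\{x\in\Phi_i^+\mid r_x\in S(W')\}$. *)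

theory Defs
  imports
    "HOL-Analysis.Analysis"
    "HOL-Algebra.Group_Action"
    "HOL-Algebra.Generated_Groups"
    "HOL-Library.Extended_Nat"
begin

definition PLC :: "'a::real_vector set \<Rightarrow> 'a set" where
  "PLC A = {\<Sum>a\<in>F. c a *\<^sub>R a | F c.
     finite F \<and> F \<subseteq> A \<and> (\<forall>a\<in>F. 0 \<le> c a) \<and> (\<exists>a\<in>F. 0 < c a)}"

definition coxeter_datum ::
  "'s set \<Rightarrow> ('v1::real_vector \<Rightarrow> 'v2::real_vector \<Rightarrow> real) \<Rightarrow> ('s \<Rightarrow> 'v1) \<Rightarrow> ('s \<Rightarrow> 'v2) \<Rightarrow> bool" where
  "coxeter_datum S pair \<alpha> \<beta> \<longleftrightarrow>
     bilinear pair \<and> inj_on \<alpha> S \<and> inj_on \<beta> S \<and>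
     (\<forall>s\<in>S. pair (\<alpha> s) (\<beta> s) = 1) \<and>
     0 \<notin> PLC (\<alpha> ` S) \<and> 0 \<notin> PLC (\<beta> ` S) \<and>
     (\<forall>s\<in>S. \<alpha> s \<notin> PLC (\<alpha> ` S - {\<alpha> s})) \<and>
     (\<forall>s\<in>S. \<beta> s \<notin> PLC (\<beta> ` S - {\<beta> s})) \<and>
     (\<forall>s\<in>S. \<forall>t\<in>S. s \<noteq> t \<longrightarrow>
        pair (\<alpha> s) (\<beta> t) \<le> 0 \<and>
        (pair (\<alpha> s) (\<beta> t) = 0 \<longleftrightarrow> pair (\<alpha> t) (\<beta> s) = 0) \<and>
        ((\<exists>m::nat. m \<ge> 2 \<and> pair (\<alpha> s) (\<beta> t) * pair (\<alpha> t) (\<beta> s) = (cos (pi / real m))\<^sup>2) \<or>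
         pair (\<alpha> s) (\<beta> t) * pair (\<alpha> t) (\<beta> s) \<ge> 1))"

(* cos(pi/m)^2 is injective in m >= 2 and always < 1, so the m below is unique if it
   exists, and the remaining case is exactly that of a product >= 1. *)
definition coxeter_exponent ::
  "('v1 \<Rightarrow> 'v2 \<Rightarrow> real) \<Rightarrow> ('s \<Rightarrow> 'v1) \<Rightarrow> ('s \<Rightarrow> 'v2) \<Rightarrow> 's \<Rightarrow> 's \<Rightarrow> enat" where
  "coxeter_exponent pair \<alpha> \<beta> s t =
     (let is_exp = (\<lambda>m::nat. m \<ge> 2 \<and>
            pair (\<alpha> s) (\<beta> t) * pair (\<alpha> t) (\<beta> s) = (cos (pi / real m))\<^sup>2)
      in if s = t then 1 else if (\<exists>m. is_exp m) then enat (THE m. is_exp m) else \<infinity>)"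

(* The congruence on words generated by (s t)^m(s,t) = 1 for finite m(s,t).  As m(s,s) = 1,
   this includes s s = 1; the generators being involutions, the quotient monoid is the
   group with the usual Coxeter presentation. *)
inductive coxeter_cong :: "'s set \<Rightarrow> ('s \<Rightarrow> 's \<Rightarrow> enat) \<Rightarrow> 's list \<Rightarrow> 's list \<Rightarrow> bool"
  for S m where
  relator: "s \<in> S \<Longrightarrow> t \<in> S \<Longrightarrow> m s t = enat k \<Longrightarrow> coxeter_cong S m (concat (replicate k [s, t])) []"
| refl: "coxeter_cong S m u u"
| sym: "coxeter_cong S m u v \<Longrightarrow> coxeter_cong S m v u"
| trans: "coxeter_cong S m u v \<Longrightarrow> coxeter_cong S m v w \<Longrightarrow> coxeter_cong S m u w"
| append: "coxeter_cong S m u v \<Longrightarrow> coxeter_cong S m u' v' \<Longrightarrow> coxeter_cong S m (u @ u') (v @ v')"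

definition word_value :: "('w, 'b) monoid_scheme \<Rightarrow> ('s \<Rightarrow> 'w) \<Rightarrow> 's list \<Rightarrow> 'w" where
  "word_value W r u = foldr (\<lambda>s g. r s \<otimes>\<^bsub>W\<^esub> g) u \<one>\<^bsub>W\<^esub>"

definition coxeter_system ::
  "('w, 'b) monoid_scheme \<Rightarrow> 's set \<Rightarrow> ('s \<Rightarrow> 'w) \<Rightarrow> ('s \<Rightarrow> 's \<Rightarrow> enat) \<Rightarrow> bool" where
  "coxeter_system W S r m \<longleftrightarrow>
     group W \<and> r ` S \<subseteq> carrier W \<and> generate W (r ` S) = carrier W \<and>
     (\<forall>u\<in>lists S. \<forall>v\<in>lists S. word_value W r u = word_value W r v \<longleftrightarrow> coxeter_cong S m u v)"

definition cox_length :: "('w, 'b) monoid_scheme \<Rightarrow> 's set \<Rightarrow> ('s \<Rightarrow> 'w) \<Rightarrow> 'w \<Rightarrow> nat" where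
  "cox_length W S r w = (LEAST n. \<exists>u\<in>lists S. length u = n \<and> word_value W r u = w)"

definition reflections :: "('w, 'b) monoid_scheme \<Rightarrow> 's set \<Rightarrow> ('s \<Rightarrow> 'w) \<Rightarrow> 'w set" where
  "reflections W S r = {w \<otimes>\<^bsub>W\<^esub> r s \<otimes>\<^bsub>W\<^esub> inv\<^bsub>W\<^esub> w | w s. w \<in> carrier W \<and> s \<in> S}"

definition reflection_subgroup ::
  "('w, 'b) monoid_scheme \<Rightarrow> 's set \<Rightarrow> ('s \<Rightarrow> 'w) \<Rightarrow> 'w set \<Rightarrow> bool" where
  "reflection_subgroup W S r H \<longleftrightarrow>
     subgroup H W \<and> H = generate W (H \<inter> reflections W S r)"

definition Nbar :: "('w, 'b) monoid_scheme \<Rightarrow> 's set \<Rightarrow> ('s \<Rightarrow> 'w) \<Rightarrow> 'w \<Rightarrow> 'w set" where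
  "Nbar W S r w =
     {t \<in> reflections W S r. cox_length W S r (w \<otimes>\<^bsub>W\<^esub> t) < cox_length W S r w}"

definition canonical_generators ::
  "('w, 'b) monoid_scheme \<Rightarrow> 's set \<Rightarrow> ('s \<Rightarrow> 'w) \<Rightarrow> 'w set \<Rightarrow> 'w set" where
  "canonical_generators W S r H = {t \<in> reflections W S r. Nbar W S r t \<inter> H = {t}}"

(* In the following, (act, \<gamma>) is the action of W on one of the two spaces together with its
   family of simple roots. *)

definition roots ::
  "('w, 'b) monoid_scheme \<Rightarrow> 's set \<Rightarrow> ('w \<Rightarrow> 'v \<Rightarrow> 'v) \<Rightarrow> ('s \<Rightarrow> 'v) \<Rightarrow> 'v set" where
  "roots W S act \<gamma> = {act w (\<gamma> s) | w s. w \<in> carrier W \<and> s \<in> S}"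

definition positive_roots ::
  "('w, 'b) monoid_scheme \<Rightarrow> 's set \<Rightarrow> ('w \<Rightarrow> 'v::real_vector \<Rightarrow> 'v) \<Rightarrow> ('s \<Rightarrow> 'v) \<Rightarrow> 'v set" where
  "positive_roots W S act \<gamma> = roots W S act \<gamma> \<inter> PLC (\<gamma> ` S)"

definition root_reflection ::
  "('w, 'b) monoid_scheme \<Rightarrow> 's set \<Rightarrow> ('s \<Rightarrow> 'w) \<Rightarrow> ('w \<Rightarrow> 'v \<Rightarrow> 'v) \<Rightarrow> ('s \<Rightarrow> 'v) \<Rightarrow> 'v \<Rightarrow> 'w" where
  "root_reflection W S r act \<gamma> x =
     (THE t. \<exists>w\<in>carrier W. \<exists>s\<in>S. x = act w (\<gamma> s) \<and> t = w \<otimes>\<^bsub>W\<^esub> r s \<otimes>\<^bsub>W\<^esub> inv\<^bsub>W\<^esub> w)"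

definition canonical_roots ::
  "('w, 'b) monoid_scheme \<Rightarrow> 's set \<Rightarrow> ('s \<Rightarrow> 'w) \<Rightarrow> ('w \<Rightarrow> 'v::real_vector \<Rightarrow> 'v) \<Rightarrow> ('s \<Rightarrow> 'v) \<Rightarrow>
   'w set \<Rightarrow> 'v set" where
  "canonical_roots W S r act \<gamma> H =
     {x \<in> positive_roots W S act \<gamma>.
        root_reflection W S r act \<gamma> x \<in> canonical_generators W S r H}"

definition hat :: "'v::real_vector set \<Rightarrow> 'v \<Rightarrow> 'v set" where
  "hat \<Phi> z = {y \<in> \<Phi>. \<exists>c. c \<noteq> 0 \<and> y = c *\<^sub>R z}"

end

theory Submission
  imports Defs
begin

text \<open>
  Both the Coxeter datum itself and the family \<open>\<Delta>1\<close> are instances of one situation: involutions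
  acting on \<open>V1\<close> as reflections whose pairings are those of a generalized Cartan matrix, with the
  braid relations holding in \<open>W\<close>. There a group element \<open>w\<close> maps the simple root of a generator \<open>s\<close>
  to a positive or a negative combination of simple roots, according to whether \<open>w s\<close> is longer or
  shorter than \<open>w\<close>. For \<open>S\<close> this gives faithfulness of the action and the description of the
  inversions of \<open>w\<close> as the reflections in positive roots made negative by \<open>w\<close>. For \<open>\<Delta>1\<close> the braid
  relations follow from faithfulness, and every positive root \<open>y\<close> with reflection in \<open>W'\<close> lies in
  the cone of \<open>\<Delta>1\<close>: for some \<open>x \<in> \<Delta>1\<close> the reflection in \<open>y\<close> maps \<open>x\<close> into minus the cone, and the
  difference is a multiple of \<open>y\<close>. The reflection in \<open>x \<in> \<Delta>1\<close> makes only multiples of \<open>x\<close> in this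
  cone negative, so the reflections in \<open>\<Delta>1\<close> are exactly the canonical generators of \<open>W'\<close>.
\<close>

section \<open>Positive linear combinations\<close>

lemma PLC_I:
  "finite F \<Longrightarrow> F \<subseteq> A \<Longrightarrow> (\<And>a. a \<in> F \<Longrightarrow> 0 \<le> c a) \<Longrightarrow> \<exists>a\<in>F. 0 < c a \<Longrightarrow> (\<Sum>a\<in>F. c a *\<^sub>R a) \<in> PLC A"
  unfolding PLC_def by blast

lemma PLC_E:
  assumes "x \<in> PLC A"
  obtains F c where "finite F" "F \<subseteq> A" "\<forall>a\<in>F. 0 \<le> c a" "\<exists>a\<in>F. 0 < c a" "x = (\<Sum>a\<in>F. c a *\<^sub>R a)"
  using assms unfolding PLC_def by blast

lemma PLC_base: "a \<in> A \<Longrightarrow> a \<in> PLC A"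
  using PLC_I[of "{a}" A "\<lambda>_. 1"] by simp

lemma PLC_scale:
  assumes "x \<in> PLC A" "k > 0"
  shows "k *\<^sub>R x \<in> PLC A"
proof -
  obtain F c where *: "finite F" "F \<subseteq> A" "\<forall>a\<in>F. 0 \<le> c a" "\<exists>a\<in>F. 0 < c a" "x = (\<Sum>a\<in>F. c a *\<^sub>R a)"
    using assms(1) by (rule PLC_E)
  have "(\<Sum>a\<in>F. (k * c a) *\<^sub>R a) \<in> PLC A"
    using * assms(2) by (intro PLC_I) (auto intro: mult_pos_pos)
  then show ?thesis
    using *(5) by (simp add: scaleR_sum_right)
qed

lemma PLC_add:
  assumes "x \<in> PLC A" "y \<in> PLC A"
  shows "x + y \<in> PLC A"
proof -
  obtain F c where F: "finite F" "F \<subseteq> A" "\<forall>a\<in>F. 0 \<le> c a" "\<exists>a\<in>F. 0 < c a" "x = (\<Sum>a\<in>F. c a *\<^sub>R a)"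
    using assms(1) by (rule PLC_E)
  obtain G d where G: "finite G" "G \<subseteq> A" "\<forall>a\<in>G. 0 \<le> d a" "\<exists>a\<in>G. 0 < d a" "y = (\<Sum>a\<in>G. d a *\<^sub>R a)"
    using assms(2) by (rule PLC_E)
  \<comment> \<open>Extending both coefficient families by zero puts the two sums over the common
    support \<open>F \<union> G\<close>.\<close>
  define c' where "c' a = (if a \<in> F then c a else 0)" for a
  define d' where "d' a = (if a \<in> G then d a else 0)" for a
  have "x = (\<Sum>a\<in>F \<union> G. c' a *\<^sub>R a)"
    unfolding F(5) c'_def using F(1) G(1) by (intro sum.mono_neutral_cong_left) auto
  moreover have "y = (\<Sum>a\<in>F \<union> G. d' a *\<^sub>R a)"
    unfolding G(5) d'_def using F(1) G(1) by (intro sum.mono_neutral_cong_left) auto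
  ultimately have "x + y = (\<Sum>a\<in>F \<union> G. (c' a + d' a) *\<^sub>R a)"
    by (simp add: scaleR_add_left sum.distrib)
  moreover have "(\<Sum>a\<in>F \<union> G. (c' a + d' a) *\<^sub>R a) \<in> PLC A"
  proof (rule PLC_I)
    obtain a where "a \<in> F" "0 < c a" using F(4) by blast
    then show "\<exists>a\<in>F \<union> G. 0 < c' a + d' a"
      using G(3) by (intro bexI[of _ a]) (auto simp: c'_def d'_def add_pos_nonneg)
  qed (use F G in \<open>auto simp: c'_def d'_def\<close>)
  ultimately show ?thesis by simp
qed

text \<open>An element of \<open>PLC\<close> is built from its positive coefficients alone, so
  induction never passes through the zero vector, which need not satisfy \<open>P\<close>.\<close>

lemma PLC_induct [consumes 1, case_names base scale add]:
  assumes "x \<in> PLC A"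
    and base: "\<And>a. a \<in> A \<Longrightarrow> P a"
    and scale: "\<And>k x. k > 0 \<Longrightarrow> P x \<Longrightarrow> P (k *\<^sub>R x)"
    and add: "\<And>x y. P x \<Longrightarrow> P y \<Longrightarrow> P (x + y)"
  shows "P x"
proof -
  obtain F c where F: "finite F" "F \<subseteq> A" "\<forall>a\<in>F. 0 \<le> c a" "\<exists>a\<in>F. 0 < c a" "x = (\<Sum>a\<in>F. c a *\<^sub>R a)"
    using assms(1) by (rule PLC_E)
  \<comment> \<open>Partial sums may have only zero coefficients; this alternative covers them and
    is excluded at the end by the positive coefficient.\<close>
  have "(\<forall>a\<in>F. c a = 0) \<or> P (\<Sum>a\<in>F. c a *\<^sub>R a)"
    using F(1-3)
  proof (induction F rule: finite_induct)
    case (insert b F)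
    show ?case
    proof (cases "c b = 0")
      case True
      then show ?thesis using insert by auto
    next
      case False
      then have "P (c b *\<^sub>R b)"
        using insert.prems base scale by (metis insertI1 insert_subset order_le_less)
      moreover have "(\<forall>a\<in>F. c a = 0) \<or> P (\<Sum>a\<in>F. c a *\<^sub>R a)"
        using insert by simp
      ultimately show ?thesis
        using insert.hyps add by auto
    qed
  qed simp
  then show ?thesis using F by auto
qed

lemma PLC_subset_PLC:
  assumes "A \<subseteq> PLC B"
  shows "PLC A \<subseteq> PLC B"
proof
  fix x assume "x \<in> PLC A"
  then show "x \<in> PLC B"
    by (induction rule: PLC_induct) (use assms in \<open>auto intro: PLC_add PLC_scale\<close>)
qed

lemma PLC_mono: "A \<subseteq> B \<Longrightarrow> PLC A \<subseteq> PLC B"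
  by (rule PLC_subset_PLC) (auto intro: PLC_base)

lemma PLC_combination:
  assumes "x \<in> PLC A" "y \<in> PLC A" "0 \<le> p" "0 \<le> q" "p + q > 0"
  shows "p *\<^sub>R x + q *\<^sub>R y \<in> PLC A"
proof (cases "p = 0 \<or> q = 0")
  case True
  then show ?thesis using assms PLC_scale by fastforce
next
  case False
  then show ?thesis using assms by (intro PLC_add PLC_scale) auto
qed

text \<open>Separates the contribution of one vector. The case \<open>v = 0\<close> stands apart
  because an empty remainder is not a \<open>PLC\<close>.\<close>

lemma PLC_split:
  assumes "u \<in> PLC A"
  obtains k v where "0 \<le> k" "v = 0 \<or> v \<in> PLC (A - {x})" "u = k *\<^sub>R x + v"
proof -
  have "\<exists>k v. 0 \<le> k \<and> (v = 0 \<or> v \<in> PLC (A - {x})) \<and> u = k *\<^sub>R x + v"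
    using assms
  proof (induction rule: PLC_induct)
    case (base a)
    show ?case
    proof (cases "a = x")
      case True
      then show ?thesis by (intro exI[of _ 1] exI[of _ 0]) simp
    next
      case False
      then show ?thesis using base PLC_base[of a "A - {x}"]
        by (intro exI[of _ 0] exI[of _ a]) simp
    qed
  next
    case (scale k u)
    then obtain j v where "0 \<le> j" "v = 0 \<or> v \<in> PLC (A - {x})" "u = j *\<^sub>R x + v" by blast
    then show ?case using scale(1) PLC_scale[of v _ k]
      by (intro exI[of _ "k * j"] exI[of _ "k *\<^sub>R v"]) (auto simp: scaleR_add_right)
  next
    case (add u u')
    then obtain j v j' v' where "0 \<le> j" "v = 0 \<or> v \<in> PLC (A - {x})" "u = j *\<^sub>R x + v"
      "0 \<le> j'" "v' = 0 \<or> v' \<in> PLC (A - {x})" "u' = j' *\<^sub>R x + v'" by blast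
    then show ?case using PLC_add[of v _ v']
      by (intro exI[of _ "j + j'"] exI[of _ "v + v'"]) (auto simp: scaleR_add_left)
  qed
  then show ?thesis using that by blast
qed

section \<open>Chebyshev polynomials and dihedral words\<close>

text \<open>For \<open>n > 0\<close> this is the Chebyshev polynomial of the second kind U_(n-1).
  The shifted index makes its value at \<open>cos \<theta>\<close> equal to sin(n \<theta>) / sin
  \<theta>.\<close>

fun chebyshev :: "real \<Rightarrow> nat \<Rightarrow> real" where
  "chebyshev \<kappa> 0 = 0"
| "chebyshev \<kappa> (Suc 0) = 1"
| "chebyshev \<kappa> (Suc (Suc n)) = 2 * \<kappa> * chebyshev \<kappa> (Suc n) - chebyshev \<kappa> n"

lemma chebyshev_cos: "sin \<theta> * chebyshev (cos \<theta>) n = sin (real n * \<theta>)"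
proof (induction n rule: induct_nat_012)
  case (ge2 n)
  define a where "a = real (Suc n) * \<theta>"
  have "real (Suc (Suc n)) * \<theta> = a + \<theta>" "real n * \<theta> = a - \<theta>"
    by (auto simp: a_def algebra_simps)
  then have "sin (real (Suc (Suc n)) * \<theta>) + sin (real n * \<theta>) = 2 * cos \<theta> * sin (real (Suc n) * \<theta>)"
    unfolding a_def[symmetric] by (simp add: sin_add sin_diff)
  moreover have "sin \<theta> * chebyshev (cos \<theta>) (Suc (Suc n)) =
      2 * cos \<theta> * (sin \<theta> * chebyshev (cos \<theta>) (Suc n)) - sin \<theta> * chebyshev (cos \<theta>) n"
    by (simp add: algebra_simps)
  ultimately show ?case
    unfolding ge2 by linarith
qed auto

lemma chebyshev_cos_pos:
  assumes "0 < n" "n < m"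
  shows "chebyshev (cos (pi / real m)) n > 0"
proof -
  have m: "real m > 1" using assms by simp
  have "sin (pi / real m) > 0"
    using m by (intro sin_gt_zero) (auto simp: field_simps)
  moreover have "sin (real n * (pi / real m)) > 0"
    using assms by (intro sin_gt_zero) (auto simp: field_simps)
  ultimately show ?thesis
    using chebyshev_cos[of "pi / real m" n] by (metis zero_less_mult_pos)
qed

lemma chebyshev_cos_self: "2 \<le> m \<Longrightarrow> chebyshev (cos (pi / real m)) m = 0"
proof -
  assume m: "2 \<le> m"
  have "sin (pi / real m) > 0"
    using m by (intro sin_gt_zero) (auto simp: field_simps)
  then show ?thesis
    using chebyshev_cos[of "pi / real m" m] m by simp
qed

lemma chebyshev_ge_1:
  assumes "\<kappa> \<ge> 1"
  shows "1 \<le> chebyshev \<kappa> (Suc n)"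
proof -
  \<comment> \<open>The recursion subtracts the previous value, so the induction must also carry
    monotonicity.\<close>
  have "1 \<le> chebyshev \<kappa> (Suc n) \<and> chebyshev \<kappa> n \<le> chebyshev \<kappa> (Suc n)"
  proof (induction n)
    case (Suc n)
    then have "2 * chebyshev \<kappa> (Suc n) \<le> 2 * \<kappa> * chebyshev \<kappa> (Suc n)"
      using assms by (intro mult_right_mono) auto
    then show ?case using Suc unfolding chebyshev.simps by linarith
  qed simp
  then show ?thesis by simp
qed

section \<open>Symmetrizing a pair of pairings, and the angles pi/m\<close>

text \<open>Rescaling one of two roots by \<open>\<mu>\<close> and its coroot by the inverse makes
  both off-diagonal pairings equal to minus the geometric mean \<open>\<kappa>\<close>. Equal
  vanishing of \<open>\<gamma>\<close> and \<open>\<delta>\<close> makes this possible.\<close>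

lemma symmetrize:
  fixes \<gamma> \<delta> :: real
  assumes "0 \<le> \<gamma>" "0 \<le> \<delta>" "\<gamma> = 0 \<longleftrightarrow> \<delta> = 0"
  obtains \<kappa> \<mu> where "\<mu> > 0" "\<kappa> \<ge> 0" "\<gamma> = \<kappa> * \<mu>" "\<delta> = \<kappa> / \<mu>" "\<kappa>\<^sup>2 = \<gamma> * \<delta>"
proof (cases "\<gamma> = 0")
  case True
  then show ?thesis using that[of 1 0] assms by simp
next
  case False
  then have pos: "\<gamma> > 0" "\<delta> > 0" using assms by auto
  define m where "m = sqrt (\<gamma> / \<delta>)"
  have m: "m > 0" "m * m = \<gamma> / \<delta>"
    using pos by (auto simp: m_def)
  show ?thesis
  proof (rule that[of m "\<gamma> / m"])
    have "m * m * \<delta> = \<gamma>" using m(2) pos by simp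
    then show "\<delta> = \<gamma> / m / m" "(\<gamma> / m)\<^sup>2 = \<gamma> * \<delta>"
      using m(1) by (auto simp: nonzero_eq_divide_eq power2_eq_square ac_simps)
  qed (use m(1) pos in auto)
qed

lemma cos_pi_div_nonneg:
  assumes "2 \<le> m"
  shows "0 \<le> cos (pi / real m)"
proof (rule cos_ge_zero)
  show "- (pi / 2) \<le> pi / real m" using order_trans[of "- (pi / 2)" 0 "pi / real m"] by simp
  show "pi / real m \<le> pi / 2" using assms by (simp add: field_simps)
qed

text \<open>The angles lie in [0, pi/2], where cosine is nonnegative and injective. This is what
  makes the exponent in \<open>coxeter_exponent\<close> unique.\<close>

lemma cos_sq_inj:
  fixes m n :: nat
  assumes "2 \<le> m" "2 \<le> n" "(cos (pi / real m))\<^sup>2 = (cos (pi / real n))\<^sup>2"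
  shows "m = n"
proof -
  have bd: "0 \<le> pi / real k" "pi / real k \<le> pi / 2" if "2 \<le> k" for k
    using that by (auto simp: field_simps)
  have "cos (pi / real m) = cos (pi / real n)"
    using power2_eq_imp_eq[OF assms(3) cos_pi_div_nonneg cos_pi_div_nonneg] assms by simp
  moreover have "pi / real k \<le> pi" if "2 \<le> k" for k
    using bd(2)[OF that] pi_gt_zero by linarith
  ultimately have "pi / real m = pi / real n"
    using cos_inj_pi bd(1) assms by blast
  then have "real m = real n"
    using assms(1,2) by (simp add: nonzero_divide_eq_eq nonzero_eq_divide_eq)
  then show ?thesis by simp
qed

section \<open>Alternating words in two letters\<close>

text \<open>Letters are added on the left, so every nonempty word ends in \<open>y\<close> and the
  first letter depends on the parity of the length. Longer words thus have the shorter ones as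
  suffixes.\<close>

fun alternating :: "'i \<Rightarrow> 'i \<Rightarrow> nat \<Rightarrow> 'i list" where
  "alternating x y 0 = []"
| "alternating x y (Suc k) = (if even k then y else x) # alternating x y k"

lemma length_alternating [simp]: "length (alternating x y k) = k"
  by (induction k) auto

lemma alternating_in_lists: "x \<in> A \<Longrightarrow> y \<in> A \<Longrightarrow> alternating x y k \<in> lists A"
  by (induction k) auto

lemma alternating_add:
  "\<exists>p. length p = j \<and> set p \<subseteq> {x, y} \<and> alternating x y (j + k) = p @ alternating x y k"
proof (induction j)
  case (Suc j)
  then obtain p where p: "length p = j" "set p \<subseteq> {x, y}" "alternating x y (j + k) = p @ alternating x y k"
    by blast
  then show ?case
    by (intro exI[of _ "(if even (j + k) then y else x) # p"]) simp
qed simp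

text \<open>A prefix of an alternating word, read backwards, is again alternating. With
  \<open>j = m\<close> this turns a power relation into a braid relation.\<close>

lemma alternating_double_split:
  assumes "j \<le> 2 * m"
  shows "alternating x y (2 * m) = rev (alternating y x j) @ alternating x y (2 * m - j)"
  using assms
proof (induction j)
  case (Suc j)
  then have *: "2 * m - j = Suc (2 * m - Suc j)" by simp
  have "even (2 * m - Suc j) \<longleftrightarrow> odd j" using Suc.prems by auto
  then show ?case using Suc unfolding * by auto
qed simp

lemma alternating_snoc:
  assumes "0 < k"
  shows "\<exists>p. length p = k - 1 \<and> set p \<subseteq> {x, y} \<and> alternating x y k = p @ [y]"
  using alternating_add[of "k - 1" x y 1] assms by auto

section \<open>Groups generated by reflections\<close>

text \<open>The \<open>r i\<close> need only generate a subgroup of \<open>W\<close>, so that the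
  reflections in \<open>\<Delta>1\<close> fit. The power relations are assumed in \<open>W\<close>:
  the Coxeter presentation supplies them in one instance, a computation with a faithful action in
  the other.\<close>

locale reflection_rep = group_action W UNIV act
  for W :: "('w, 'b) monoid_scheme" (structure) and act :: "'w \<Rightarrow> 'v1::real_vector \<Rightarrow> 'v1" +
  fixes pair :: "'v1 \<Rightarrow> 'v2::real_vector \<Rightarrow> real"
    and I :: "'i set" and r :: "'i \<Rightarrow> 'w" and a :: "'i \<Rightarrow> 'v1" and b :: "'i \<Rightarrow> 'v2"
  assumes bilin: "bilinear pair"
    and r_closed: "i \<in> I \<Longrightarrow> r i \<in> carrier W"
    and r_sq: "i \<in> I \<Longrightarrow> r i \<otimes> r i = \<one>"
    and act_r: "i \<in> I \<Longrightarrow> act (r i) z = z - (2 * pair z (b i)) *\<^sub>R a i"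
    and pair_self: "i \<in> I \<Longrightarrow> pair (a i) (b i) = 1"
    and pair_nonpos: "i \<in> I \<Longrightarrow> j \<in> I \<Longrightarrow> i \<noteq> j \<Longrightarrow> pair (a i) (b j) \<le> 0"
    and pair_zero: "i \<in> I \<Longrightarrow> j \<in> I \<Longrightarrow> i \<noteq> j \<Longrightarrow> pair (a i) (b j) = 0 \<Longrightarrow> pair (a j) (b i) = 0"
    and pair_prod: "i \<in> I \<Longrightarrow> j \<in> I \<Longrightarrow> i \<noteq> j \<Longrightarrow>
      (\<exists>m::nat. m \<ge> 2 \<and> pair (a i) (b j) * pair (a j) (b i) = (cos (pi / real m))\<^sup>2 \<and> (r i \<otimes> r j) [^] m = \<one>) \<or>
      pair (a i) (b j) * pair (a j) (b i) \<ge> 1"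
    and zero_notin: "0 \<notin> PLC (a ` I)"
begin

sublocale group W
  using group_hom group_hom.axioms(1) by blast

lemmas pair_simps = bilinear_ladd[OF bilin] bilinear_radd[OF bilin] bilinear_lmul[OF bilin]
  bilinear_rmul[OF bilin] bilinear_lneg[OF bilin] bilinear_rneg[OF bilin] bilinear_lsub[OF bilin]
  bilinear_rsub[OF bilin] bilinear_lzero[OF bilin] bilinear_rzero[OF bilin]

lemma act_mult: "g \<in> carrier W \<Longrightarrow> h \<in> carrier W \<Longrightarrow> act (g \<otimes> h) z = act g (act h z)"
  using composition_rule by simp

lemma act_one: "act \<one> z = z"
  using id_eq_one by (metis UNIV_I restrict_apply)

lemma act_inv_cancel: "g \<in> carrier W \<Longrightarrow> act (inv g) (act g z) = z" "g \<in> carrier W \<Longrightarrow> act g (act (inv g) z) = z"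
  using act_mult[of "inv g" g z] act_mult[of g "inv g" z] act_one by auto

section \<open>Words, the generated subgroup and its length function\<close>

definition val :: "'i list \<Rightarrow> 'w" where "val u = word_value W r u"

definition G :: "'w set" where "G = val ` lists I"

text \<open>Length is relative to the generators indexed by \<open>I\<close>, and meaningful only on
  \<open>G\<close>, where some word exists.\<close>

abbreviation len :: "'w \<Rightarrow> nat" where "len \<equiv> cox_length W I r"

lemma val_Nil [simp]: "val [] = \<one>"
  by (simp add: val_def word_value_def)

lemma val_Cons [simp]: "val (i # u) = r i \<otimes> val u"
  by (simp add: val_def word_value_def)

lemma val_closed: "u \<in> lists I \<Longrightarrow> val u \<in> carrier W"
  by (induction u) (auto simp: r_closed)

lemma val_append: "u \<in> lists I \<Longrightarrow> v \<in> lists I \<Longrightarrow> val (u @ v) = val u \<otimes> val v"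
  by (induction u) (auto simp: r_closed val_closed m_assoc)

lemma val_single: "i \<in> I \<Longrightarrow> val [i] = r i"
  by (simp add: r_closed)

lemma inv_r: "i \<in> I \<Longrightarrow> inv (r i) = r i"
  using r_sq r_closed by (simp add: inv_equality)

lemma val_rev: "u \<in> lists I \<Longrightarrow> val (rev u) = inv (val u)"
proof (induction u)
  case (Cons i u)
  then have "rev u \<in> lists I" "[i] \<in> lists I" by auto
  then have "val (rev (i # u)) = val (rev u) \<otimes> val [i]"
    by (simp only: rev.simps val_append)
  then show ?case
    using Cons by (simp add: inv_mult_group inv_r r_closed val_closed)
qed simp

lemma G_closed: "g \<in> G \<Longrightarrow> g \<in> carrier W"
  unfolding G_def using val_closed by auto

lemma one_G: "\<one> \<in> G"
  unfolding G_def using val_Nil by (metis image_eqI lists.Nil)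

lemma r_G: "i \<in> I \<Longrightarrow> r i \<in> G"
  unfolding G_def using val_single by (metis image_eqI lists.simps)

lemma mult_G: "g \<in> G \<Longrightarrow> h \<in> G \<Longrightarrow> g \<otimes> h \<in> G"
  unfolding G_def using val_append by (smt (verit) append_in_lists_conv image_iff)

lemma inv_G: "g \<in> G \<Longrightarrow> inv g \<in> G"
  unfolding G_def using val_rev by (smt (verit) image_iff in_lists_conv_set set_rev)

lemma subgroup_G: "subgroup G W"
  by (rule subgroupI) (use G_closed one_G mult_G inv_G in auto)

lemma generate_eq_G: "generate W (r ` I) = G"
proof
  show "generate W (r ` I) \<subseteq> G"
    using r_G by (intro generate_subgroup_incl[OF _ subgroup_G]) auto
  have "val u \<in> generate W (r ` I)" if "u \<in> lists I" for u
    using that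
  proof (induction u)
    case (Cons i u)
    then show ?case using generate.eng[OF generate.incl[of "r i" "r ` I" W], of "val u"] by simp
  qed (simp add: generate.one)
  then show "G \<subseteq> generate W (r ` I)" by (auto simp: G_def)
qed

lemma G_induct [consumes 1, case_names one step]:
  assumes "g \<in> G" "P \<one>" "\<And>i g. i \<in> I \<Longrightarrow> g \<in> G \<Longrightarrow> P g \<Longrightarrow> P (r i \<otimes> g)"
  shows "P g"
proof -
  have "P (val u)" if "u \<in> lists I" for u
    using that by (induction u) (use assms(2,3) in \<open>auto simp: G_def\<close>)
  then show ?thesis using assms(1) by (auto simp: G_def)
qed

text \<open>A \<open>group_action\<close> only permutes vectors; linearity is inherited from the
  formula for the generators.\<close>

lemma act_linear: "g \<in> G \<Longrightarrow> linear (act g)"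
proof (induction rule: G_induct)
  case one
  then show ?case by (simp add: linear_iff act_one)
next
  case (step i g)
  then show ?case
    by (simp add: linear_iff act_mult r_closed G_closed act_r pair_simps algebra_simps)
qed

lemma len_le: "u \<in> lists I \<Longrightarrow> len (val u) \<le> length u"
  unfolding cox_length_def val_def by (intro Least_le) blast

lemma reduced_word:
  assumes "g \<in> G"
  obtains u where "u \<in> lists I" "length u = len g" "val u = g"
proof -
  have "\<exists>n. \<exists>u\<in>lists I. length u = n \<and> word_value W r u = g"
    using assms by (auto simp: G_def val_def)
  from LeastI_ex[OF this] show ?thesis
    using that unfolding cox_length_def val_def by blast
qed

lemma len_mult_le:
  assumes "g \<in> G" "u \<in> lists I"
  shows "len (g \<otimes> val u) \<le> len g + length u"
proof -
  obtain v where "v \<in> lists I" "length v = len g" "val v = g" using reduced_word assms(1) by blast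
  then show ?thesis
    using len_le[of "v @ u"] val_append[of v u] assms(2) by simp
qed

lemma right_cancel_r: "g \<in> G \<Longrightarrow> i \<in> I \<Longrightarrow> g \<otimes> r i \<otimes> r i = g"
  by (simp add: G_closed m_assoc r_closed r_sq)

text \<open>The last letter of a reduced word is a right descent.\<close>

lemma exists_descent:
  assumes "g \<in> G" "g \<noteq> \<one>"
  obtains i where "i \<in> I" "len (g \<otimes> r i) < len g"
proof -
  obtain u where u: "u \<in> lists I" "length u = len g" "val u = g" using reduced_word assms(1) by blast
  then obtain v i where v: "u = v @ [i]" using assms(2) by (metis rev_exhaust val_Nil)
  then have vi: "v \<in> lists I" "i \<in> I" using u by auto
  then have "g = val v \<otimes> r i" using u v val_append[of v "[i]"] val_single by simp
  then have "g \<otimes> r i = val v" using vi right_cancel_r by (auto simp: G_def)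
  then have "len (g \<otimes> r i) < len g" using len_le[OF vi(1)] u v by simp
  then show ?thesis using that vi by blast
qed

section \<open>Dihedral words and positivity of images of simple roots\<close>

lemma val_alternating_double:
  assumes "x \<in> I" "y \<in> I"
  shows "val (alternating x y (2 * m)) = (r x \<otimes> r y) [^] m"
proof (induction m)
  case (Suc m)
  have "val (alternating x y (2 * Suc m)) = (r x \<otimes> r y) \<otimes> val (alternating x y (2 * m))"
    using assms val_closed[OF alternating_in_lists[of x I y "2 * m"]] by (simp add: m_assoc r_closed)
  then show ?case
    unfolding Suc using assms nat_pow_Suc2 r_closed by simp
qed simp

text \<open>The word of length 2m representing \<open>(r x \<otimes> r y) [^] m\<close> is cut in
  the middle; its first half is the inverse of \<open>alternating y x m\<close>.\<close>

lemma braid: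
  assumes "x \<in> I" "y \<in> I" "(r x \<otimes> r y) [^] m = \<one>"
  shows "val (alternating x y m) = val (alternating y x m)"
proof -
  have l: "alternating x y m \<in> lists I" "alternating y x m \<in> lists I"
    using assms by (simp_all only: alternating_in_lists)
  have "\<one> = val (rev (alternating y x m) @ alternating x y m)"
    using val_alternating_double[OF assms(1,2), of m] alternating_double_split[of m m x y] assms(3) by simp
  also have "\<dots> = inv (val (alternating y x m)) \<otimes> val (alternating x y m)"
    using l by (subst val_append) (auto simp: val_rev)
  finally show ?thesis
    using l val_closed by (metis inv_closed inv_equality inv_inv)
qed

text \<open>In the coordinates with respect to \<open>a x\<close> and
  \<open>\<mu> *\<^sub>R a y\<close> both off-diagonal pairings are \<open>- \<kappa>\<close>, so
  each further letter changes one coordinate by a step of the Chebyshev recursion. Parity tells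
  which one changed last.\<close>

lemma act_alternating:
  assumes xy: "x \<in> I" "y \<in> I"
    and c: "pair (a x) (b y) = - (\<kappa> * \<mu>)" "pair (a y) (b x) = - (\<kappa> / \<mu>)" "\<mu> > 0"
  shows "act (val (alternating x y k)) (a x) =
    (if even k then chebyshev \<kappa> (Suc k) *\<^sub>R a x + (\<mu> * chebyshev \<kappa> k) *\<^sub>R a y
     else chebyshev \<kappa> k *\<^sub>R a x + (\<mu> * chebyshev \<kappa> (Suc k)) *\<^sub>R a y)"
proof (induction k)
  case 0
  then show ?case by (simp add: act_one)
next
  case (Suc k)
  have "val (alternating x y k) \<in> carrier W"
    using xy by (intro val_closed alternating_in_lists)
  then have step: "act (val (alternating x y (Suc k))) (a x) =
      act (r (if even k then y else x)) (act (val (alternating x y k)) (a x))"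
    using xy by (simp add: act_mult r_closed)
  show ?case
  proof (cases "even k")
    case True
    then show ?thesis
      unfolding step Suc using xy c
      by (simp add: act_r pair_simps pair_self algebra_simps)
        (simp add: algebra_simps flip: scaleR_add_left)
  next
    case False
    then show ?thesis
      unfolding step Suc using xy c
      by (simp add: act_r pair_simps pair_self algebra_simps)
        (simp add: algebra_simps flip: scaleR_add_left)
  qed
qed

text \<open>The maximal alternating suffix of a reduced word for \<open>w\<close> splits off a dihedral factor; it
  is shorter than the braid relation since \<open>r x\<close> is not a right descent of \<open>w\<close>.\<close>

theorem act_in_PLC:
  assumes "w \<in> G" "x \<in> I" "len w \<le> len (w \<otimes> r x)"
  shows "act w (a x) \<in> PLC (a ` I)"
  using assms
proof (induction "len w" arbitrary: w x rule: less_induct)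
  case less
  note w = \<open>w \<in> G\<close> and x = \<open>x \<in> I\<close>
  show ?case
  proof (cases "w = \<one>")
    case True
    then show ?thesis using x by (simp add: act_one PLC_base)
  next
    case False
    then obtain y where y: "y \<in> I" "len (w \<otimes> r y) < len w" using exists_descent w by blast
    have xy: "x \<noteq> y" using y less.prems by auto
    \<comment> \<open>\<open>suffix k\<close> is a length-additive factorization of \<open>w\<close>
      with an alternating right factor of length \<open>k\<close>. Since \<open>k\<close> is at most
      \<open>len w\<close>, a greatest one exists.\<close>
    define suffix where "suffix k \<longleftrightarrow> (\<exists>v\<in>G. w = v \<otimes> val (alternating x y k) \<and> len w = len v + k)" for k
    have alt: "alternating x y k \<in> lists I" "alternating y x k \<in> lists I" for k
      using x y by (simp_all only: alternating_in_lists)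
    have rG: "r x \<in> G" "r y \<in> G" using x y r_G by auto
    have "suffix 1"
    proof -
      have "len (w \<otimes> r y \<otimes> val [y]) \<le> len (w \<otimes> r y) + 1"
        using len_mult_le[of "w \<otimes> r y" "[y]"] w rG mult_G y by simp
      moreover have "w \<otimes> r y \<otimes> val [y] = w"
        using w y right_cancel_r val_single by simp
      ultimately show ?thesis
        unfolding suffix_def using y w rG mult_G by (intro bexI[of _ "w \<otimes> r y"]) auto
    qed
    moreover have bound: "k \<le> len w" if "suffix k" for k using that suffix_def by auto
    ultimately obtain k where k: "suffix k" "\<And>j. suffix j \<Longrightarrow> j \<le> k"
      using GreatestI_nat[of suffix 1 "len w"] Greatest_le_nat[of suffix _ "len w"] by blast
    have k1: "1 \<le> k" using k(2) \<open>suffix 1\<close> by blast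
    obtain v where v: "v \<in> G" "w = v \<otimes> val (alternating x y k)" "len w = len v + k"
      using k(1) suffix_def by blast
    \<comment> \<open>\<open>z\<close> is the letter that would lengthen the suffix, and
      \<open>z'\<close> is its present first letter; together they are \<open>x\<close> and
      \<open>y\<close>.\<close>
    define z z' where "z = (if even k then y else x)" and "z' = (if even k then x else y)"
    have zI: "z \<in> I" "z' \<in> I" using x y by (auto simp: z_def z'_def)
    \<comment> \<open>A descent \<open>z\<close> of \<open>v\<close> could be moved into the suffix,
      against maximality.\<close>
    have "len v \<le> len (v \<otimes> r z)"
    proof (rule ccontr)
      assume "\<not> ?thesis"
      then have lt: "len (v \<otimes> r z) < len v" by simp
      have vz: "v \<otimes> r z \<in> G" using v(1) zI r_G mult_G by blast
      have "v \<otimes> r z \<otimes> val (alternating x y (Suc k)) = v \<otimes> r z \<otimes> r z \<otimes> val (alternating x y k)"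
        using vz zI val_closed[OF alt(1)] by (simp add: z_def G_closed r_closed m_assoc)
      then have eq: "v \<otimes> r z \<otimes> val (alternating x y (Suc k)) = w"
        using v zI right_cancel_r by simp
      have "len w \<le> len (v \<otimes> r z) + Suc k"
        using len_mult_le[OF vz alt(1), of "Suc k"] eq by simp
      then have "suffix (Suc k)"
        unfolding suffix_def using vz eq lt v(3) by (intro bexI[of _ "v \<otimes> r z"]) auto
      then show False using k(2) by fastforce
    qed
    \<comment> \<open>A descent \<open>z'\<close> of \<open>v\<close> would cancel the first letter
      of the suffix and make \<open>w\<close> too short.\<close>
    moreover have "len v \<le> len (v \<otimes> r z')"
    proof (rule ccontr)
      assume "\<not> ?thesis"
      then have lt: "len (v \<otimes> r z') < len v" by simp
      have vz: "v \<otimes> r z' \<in> G" using v(1) zI r_G mult_G by blast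
      obtain j where j: "k = Suc j" using k1 by (cases k) auto
      have "w = v \<otimes> r z' \<otimes> val (alternating x y j)"
        using v zI val_closed[OF alt(1), of j] by (simp add: j z'_def G_closed r_closed m_assoc)
      then have "len w \<le> len (v \<otimes> r z') + j"
        using len_mult_le[OF vz alt(1), of j] by simp
      then show False using lt v(3) j by simp
    qed
    ultimately have vxy: "len v \<le> len (v \<otimes> r x)" "len v \<le> len (v \<otimes> r y)"
      by (auto simp: z_def z'_def split: if_splits)
    have lv: "len v < len w" using v(3) k1 by simp
    have pos: "act v (a x) \<in> PLC (a ` I)" "act v (a y) \<in> PLC (a ` I)"
      using less.hyps[OF lv v(1) x vxy(1)] less.hyps[OF lv v(1) y(1) vxy(2)] by auto
    have "0 \<le> - pair (a x) (b y)" "0 \<le> - pair (a y) (b x)"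
      "- pair (a x) (b y) = 0 \<longleftrightarrow> - pair (a y) (b x) = 0"
      subgoal using pair_nonpos[OF x y(1) xy] by linarith
      subgoal using pair_nonpos[OF y(1) x xy[symmetric]] by linarith
      subgoal using pair_zero[OF x y(1) xy] pair_zero[OF y(1) x xy[symmetric]] by linarith
      done
    then obtain \<kappa> \<mu> where \<mu>: "\<mu> > 0" "\<kappa> \<ge> 0" and e: "- pair (a x) (b y) = \<kappa> * \<mu>" "- pair (a y) (b x) = \<kappa> / \<mu>"
        and sq: "\<kappa>\<^sup>2 = (- pair (a x) (b y)) * (- pair (a y) (b x))"
      by (rule symmetrize)
    have sq: "\<kappa>\<^sup>2 = pair (a x) (b y) * pair (a y) (b x)" using sq by simp
    have c: "pair (a x) (b y) = - (\<kappa> * \<mu>)" "pair (a y) (b x) = - (\<kappa> / \<mu>)" using e by linarith+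
    \<comment> \<open>One coefficient has to be strictly positive, since the zero combination is not
      in the cone; the other vanishes when \<open>Suc k = m\<close>.\<close>
    have q: "0 < chebyshev \<kappa> k \<and> 0 \<le> chebyshev \<kappa> (Suc k)"
      using pair_prod[OF x y(1) xy]
    proof
      assume "\<exists>m::nat. m \<ge> 2 \<and> pair (a x) (b y) * pair (a y) (b x) = (cos (pi / real m))\<^sup>2 \<and> (r x \<otimes> r y) [^] m = \<one>"
      then obtain m :: nat where m: "m \<ge> 2" "\<kappa>\<^sup>2 = (cos (pi / real m))\<^sup>2" "(r x \<otimes> r y) [^] m = \<one>"
        using sq by auto
      \<comment> \<open>Otherwise the braid relation makes the suffix end in \<open>x\<close>, and
        multiplying by \<open>r x\<close> deletes that letter, so \<open>w \<otimes> r x\<close> is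
        shorter than \<open>w\<close>.\<close>
      have "k < m"
      proof (rule ccontr)
        assume "\<not> k < m"
        then obtain p where p: "length p = k - m" "set p \<subseteq> {x, y}" "alternating x y k = p @ alternating x y m"
          using alternating_add[of "k - m" x y m] by auto
        obtain p' where p': "length p' = m - 1" "set p' \<subseteq> {y, x}" "alternating y x m = p' @ [x]"
          using alternating_snoc[of m y x] m(1) by auto
        have pI: "p \<in> lists I" "p' \<in> lists I" "[x] \<in> lists I" "p @ p' \<in> lists I"
          using p(2) p'(2) x y by auto
        have "val (alternating x y k) = val p \<otimes> val (p' @ [x])"
          unfolding p(3) p'(3)[symmetric] using pI alt by (simp add: val_append braid[OF x y(1) m(3)])
        also have "\<dots> = val (p @ p') \<otimes> r x"
          using pI val_append val_single[OF x] val_closed r_closed[OF x] by (simp only: m_assoc val_append)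
        finally have "w \<otimes> r x = v \<otimes> val (p @ p') \<otimes> r x \<otimes> r x"
          using v(1,2) pI val_closed[OF pI(4)] r_closed[OF x] by (simp add: m_assoc G_closed)
        also have "\<dots> = v \<otimes> val (p @ p')"
          using v(1) pI x by (intro right_cancel_r mult_G) (auto simp: G_def)
        finally have "len (w \<otimes> r x) \<le> len v + (length p + length p')"
          using len_mult_le[OF v(1) pI(4)] by simp
        moreover have "length p + length p' < k" using p(1) p'(1) m(1) \<open>\<not> k < m\<close> by simp
        ultimately show False using less.prems(3) v(3) by simp
      qed
      have "0 \<le> cos (pi / real m)" using m(1) by (rule cos_pi_div_nonneg)
      then have "\<kappa> = cos (pi / real m)" using m(2) \<mu>(2) by (simp add: power2_eq_imp_eq)
      then show ?thesis
        using chebyshev_cos_pos[of k m] chebyshev_cos_pos[of "Suc k" m] chebyshev_cos_self[OF m(1)] \<open>k < m\<close> k1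
        by (cases "Suc k = m") auto
    next
      assume "pair (a x) (b y) * pair (a y) (b x) \<ge> 1"
      then have "1\<^sup>2 \<le> \<kappa>\<^sup>2" using sq by simp
      then have "1 \<le> \<kappa>" using \<mu>(2) by (rule power2_le_imp_le)
      then show ?thesis
        using chebyshev_ge_1[of \<kappa> "k - 1"] chebyshev_ge_1[of \<kappa> k] k1 by simp
    qed
    have "act w (a x) = act v (act (val (alternating x y k)) (a x))"
      unfolding v(2) using v(1) val_closed[OF alt(1)] by (simp add: act_mult G_closed)
    moreover have "0 < chebyshev \<kappa> k + \<mu> * chebyshev \<kappa> (Suc k)" "0 < chebyshev \<kappa> (Suc k) + \<mu> * chebyshev \<kappa> k"
      using q \<mu>(1) by (auto intro: add_pos_nonneg add_nonneg_pos)
    ultimately show ?thesis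
      using q \<mu> pos act_linear[OF v(1)]
      by (auto simp: act_alternating[OF x y(1) c \<mu>(1)] linear_add linear_scale intro!: PLC_combination)
  qed
qed

text \<open>\<open>r x\<close> negates \<open>a x\<close>, and \<open>w \<otimes> r x\<close> falls
  under the previous theorem.\<close>

lemma act_neg_in_PLC:
  assumes "w \<in> G" "x \<in> I" "len (w \<otimes> r x) < len w"
  shows "- act w (a x) \<in> PLC (a ` I)"
proof -
  have "act (w \<otimes> r x) (a x) \<in> PLC (a ` I)"
    using assms right_cancel_r by (intro act_in_PLC) (auto intro: mult_G r_G)
  moreover have "act (w \<otimes> r x) (a x) = - act w (a x)"
    using assms act_linear[OF assms(1)] pair_self[OF assms(2)]
    by (simp add: act_mult G_closed r_closed act_r linear_diff linear_neg linear_scale scaleR_2)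
  ultimately show ?thesis by simp
qed

section \<open>Extremal rays of the cone and faithfulness\<close>

lemma pair_PLC_nonpos:
  assumes "v \<in> PLC (a ` I - {a i})" "i \<in> I"
  shows "pair v (b i) \<le> 0"
  using assms(1)
proof (induction rule: PLC_induct)
  case (base z)
  then obtain j where "j \<in> I" "z = a j" "j \<noteq> i" by blast
  then show ?case using pair_nonpos assms(2) by auto
next
  case (scale k x)
  then show ?case by (simp add: pair_simps mult_le_0_iff)
next
  case (add x y)
  then show ?case by (simp add: pair_simps)
qed

text \<open>The ray of \<open>a i\<close> is extremal. The simple roots may be linearly dependent,
  so coefficients cannot be compared; instead the part away from \<open>a i\<close> is a multiple of
  \<open>a i\<close>, pairing with \<open>b i\<close> shows the factor is at most 0, and zero would
  then lie in the cone.\<close>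

lemma PLC_eq_simple:
  assumes "u \<in> PLC (a ` I)" "u' \<in> PLC (a ` I)" "i \<in> I" "u + u' = K *\<^sub>R a i"
  obtains c where "c > 0" "u = c *\<^sub>R a i"
proof -
  let ?A = "a ` I - {a i}"
  have A: "PLC ?A \<subseteq> PLC (a ` I)" by (rule PLC_mono) auto
  obtain k v where v: "0 \<le> k" "v = 0 \<or> v \<in> PLC ?A" "u = k *\<^sub>R a i + v"
    using assms(1) by (rule PLC_split)
  obtain k' v' where v': "0 \<le> k'" "v' = 0 \<or> v' \<in> PLC ?A" "u' = k' *\<^sub>R a i + v'"
    using assms(2) by (rule PLC_split)
  have "v = 0"
  proof (rule ccontr)
    assume "v \<noteq> 0"
    then have vv: "v + v' \<in> PLC ?A" using v(2) v'(2) PLC_add by fastforce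
    define L where "L = K - k - k'"
    have L: "v + v' = L *\<^sub>R a i"
      using assms(4) v(3) v'(3) by (simp add: L_def algebra_simps)
    then have "L \<le> 0" using pair_PLC_nonpos[OF vv assms(3)] pair_self[OF assms(3)] by (simp add: pair_simps)
    then have "0 \<in> PLC (a ` I)"
    proof (cases "L = 0")
      case True
      then show ?thesis using vv A L by auto
    next
      case False
      then have "(v + v') + (- L) *\<^sub>R a i \<in> PLC (a ` I)"
        using assms(3) False \<open>L \<le> 0\<close>
        by (intro PLC_add[OF subsetD[OF A vv]] PLC_scale PLC_base) auto
      then show ?thesis using L by simp
    qed
    then show False using zero_notin by simp
  qed
  moreover have "k \<noteq> 0" using calculation assms(1) zero_notin v(3) by auto
  ultimately show ?thesis using v that[of k] by simp
qed

text \<open>The sum of \<open>u\<close> and \<open>- act (r i) u\<close> is a multiple of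
  \<open>a i\<close>, so extremality applies.\<close>

lemma reflection_sign_change:
  assumes "u \<in> PLC (a ` I)" "- act (r i) u \<in> PLC (a ` I)" "i \<in> I"
  obtains c where "c > 0" "u = c *\<^sub>R a i"
  using assms(1,2,3)
  by (rule PLC_eq_simple[where K = "2 * pair u (b i)"]) (auto simp: act_r assms(3) intro: that)

text \<open>A nontrivial element has a descent, and the corresponding simple root becomes
  negative.\<close>

lemma eq_one_if_simple_positive:
  assumes "g \<in> G" "\<And>j. j \<in> I \<Longrightarrow> - act g (a j) \<notin> PLC (a ` I)"
  shows "g = \<one>"
  using assms act_neg_in_PLC exists_descent by metis

lemma faithful:
  assumes "g \<in> G" "\<And>z. act g z = z"
  shows "g = \<one>"
proof (rule eq_one_if_simple_positive[OF assms(1)])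
  fix j assume "j \<in> I"
  then have "a j \<in> PLC (a ` I)" by (simp add: PLC_base)
  then show "- act g (a j) \<notin> PLC (a ` I)"
    using PLC_add[of "a j" "a ` I" "- a j"] zero_notin assms(2) by auto
qed

end

section \<open>Roots of a Coxeter datum\<close>

locale coxeter_rep =
  fixes S :: "'s set"
    and pair :: "'v1::real_vector \<Rightarrow> 'v2::real_vector \<Rightarrow> real"
    and \<alpha> :: "'s \<Rightarrow> 'v1" and \<beta> :: "'s \<Rightarrow> 'v2"
    and W :: "('w, 'b) monoid_scheme" (structure) and r :: "'s \<Rightarrow> 'w"
    and act1 :: "'w \<Rightarrow> 'v1 \<Rightarrow> 'v1" and act2 :: "'w \<Rightarrow> 'v2 \<Rightarrow> 'v2"
    and \<phi> :: "'v1 \<Rightarrow> 'v2"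
  assumes datum: "coxeter_datum S pair \<alpha> \<beta>"
    and system: "coxeter_system W S r (coxeter_exponent pair \<alpha> \<beta>)"
    and action1: "group_action W UNIV act1"
    and action1_gen: "\<And>s x. s \<in> S \<Longrightarrow> act1 (r s) x = x - (2 * pair x (\<beta> s)) *\<^sub>R \<alpha> s"
    and action2: "group_action W UNIV act2"
    and action2_gen: "\<And>s y. s \<in> S \<Longrightarrow> act2 (r s) y = y - (2 * pair (\<alpha> s) y) *\<^sub>R \<beta> s"
    and phi_bij: "bij_betw \<phi> (roots W S act1 \<alpha>) (roots W S act2 \<beta>)"
    and phi_equivariant: "\<And>w x. w \<in> carrier W \<Longrightarrow> x \<in> roots W S act1 \<alpha> \<Longrightarrow> \<phi> (act1 w x) = act2 w (\<phi> x)"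
    and phi_simple: "\<And>s. s \<in> S \<Longrightarrow> \<phi> (\<alpha> s) = \<beta> s"
begin

section \<open>The Coxeter datum as a reflection representation\<close>

lemma word_value_power:
  assumes "s \<in> S" "t \<in> S"
  shows "word_value W r (concat (replicate k [s, t])) = (r s \<otimes> r t) [^] k"
proof -
  interpret group W using system by (simp add: coxeter_system_def)
  have rc: "r s \<in> carrier W" "r t \<in> carrier W"
    using system assms by (auto simp: coxeter_system_def)
  show ?thesis
  proof (induction k)
    case 0
    then show ?case by (simp add: word_value_def)
  next
    case (Suc k)
    have "word_value W r (concat (replicate (Suc k) [s, t]))
        = r s \<otimes> (r t \<otimes> word_value W r (concat (replicate k [s, t])))"
      by (simp add: word_value_def)
    also have "\<dots> = (r s \<otimes> r t) [^] Suc k"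
      unfolding Suc using rc nat_pow_Suc2[of "r s \<otimes> r t" k] by (simp add: m_assoc)
    finally show ?case .
  qed
qed

lemma power_exponent:
  assumes "s \<in> S" "t \<in> S" "coxeter_exponent pair \<alpha> \<beta> s t = enat k"
  shows "(r s \<otimes> r t) [^] k = \<one>"
proof -
  have "coxeter_cong S (coxeter_exponent pair \<alpha> \<beta>) (concat (replicate k [s, t])) []"
    using assms by (rule coxeter_cong.relator)
  moreover have "concat (replicate k [s, t]) \<in> lists S" "[] \<in> lists S" using assms by (auto split: if_splits)
  ultimately have "word_value W r (concat (replicate k [s, t])) = word_value W r []"
    using system unfolding coxeter_system_def by blast
  then show ?thesis
    using word_value_power[OF assms(1,2)] by (simp add: word_value_def)
qed

lemma coxeter_exponent_eq:
  assumes "s \<noteq> t" "2 \<le> m" "pair (\<alpha> s) (\<beta> t) * pair (\<alpha> t) (\<beta> s) = (cos (pi / real m))\<^sup>2"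
  shows "coxeter_exponent pair \<alpha> \<beta> s t = enat m"
proof -
  have "(THE m::nat. m \<ge> 2 \<and> pair (\<alpha> s) (\<beta> t) * pair (\<alpha> t) (\<beta> s) = (cos (pi / real m))\<^sup>2) = m"
    using assms cos_sq_inj by (intro the_equality) auto
  then show ?thesis using assms unfolding coxeter_exponent_def Let_def by auto
qed

sublocale reflection_rep W act1 pair S r \<alpha> \<beta>
proof (intro reflection_rep.intro action1 reflection_rep_axioms.intro)
  show "bilinear pair" using datum by (simp add: coxeter_datum_def)
  show "0 \<notin> PLC (\<alpha> ` S)" using datum by (simp add: coxeter_datum_def)
  fix s assume s: "s \<in> S"
  show rc: "r s \<in> carrier W" using system s by (auto simp: coxeter_system_def)
  \<comment> \<open>The diagonal exponent is 1, so its relator says that \<open>r s\<close> is an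
    involution.\<close>
  have "(r s \<otimes> r s) [^] (1::nat) = \<one>"
    using s by (intro power_exponent) (auto simp: coxeter_exponent_def one_enat_def)
  moreover have "group W" using system by (simp add: coxeter_system_def)
  ultimately show "r s \<otimes> r s = \<one>"
    using rc by (simp add: group.is_monoid monoid.nat_pow_0 monoid.nat_pow_Suc monoid.l_one monoid.m_closed)
  show "act1 (r s) z = z - (2 * pair z (\<beta> s)) *\<^sub>R \<alpha> s" for z using action1_gen s by blast
  show "pair (\<alpha> s) (\<beta> s) = 1" using datum s by (simp add: coxeter_datum_def)
  fix t assume t: "t \<in> S" "s \<noteq> t"
  have D: "pair (\<alpha> s) (\<beta> t) \<le> 0 \<and> (pair (\<alpha> s) (\<beta> t) = 0 \<longleftrightarrow> pair (\<alpha> t) (\<beta> s) = 0) \<and>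
        ((\<exists>m::nat. m \<ge> 2 \<and> pair (\<alpha> s) (\<beta> t) * pair (\<alpha> t) (\<beta> s) = (cos (pi / real m))\<^sup>2) \<or>
         pair (\<alpha> s) (\<beta> t) * pair (\<alpha> t) (\<beta> s) \<ge> 1)"
    using datum s t by (simp add: coxeter_datum_def)
  then show "pair (\<alpha> s) (\<beta> t) \<le> 0" "pair (\<alpha> s) (\<beta> t) = 0 \<Longrightarrow> pair (\<alpha> t) (\<beta> s) = 0" by blast+
  show "(\<exists>m::nat. m \<ge> 2 \<and> pair (\<alpha> s) (\<beta> t) * pair (\<alpha> t) (\<beta> s) = (cos (pi / real m))\<^sup>2 \<and> (r s \<otimes> r t) [^] m = \<one>) \<or>
      pair (\<alpha> s) (\<beta> t) * pair (\<alpha> t) (\<beta> s) \<ge> 1"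
    using D power_exponent[OF s t(1)] coxeter_exponent_eq[OF t(2)] by blast
qed

lemma G_eq_carrier: "G = carrier W"
  using generate_eq_G system by (simp add: coxeter_system_def)

lemma act1_linear: "g \<in> carrier W \<Longrightarrow> linear (act1 g)"
  using act_linear G_eq_carrier by simp

section \<open>The second action and invariance of the pairing\<close>

interpretation dual: group_action W UNIV act2 by (rule action2)

lemma act2_mult: "g \<in> carrier W \<Longrightarrow> h \<in> carrier W \<Longrightarrow> act2 (g \<otimes> h) z = act2 g (act2 h z)"
  using dual.composition_rule by simp

lemma act2_one: "act2 \<one> z = z"
  using dual.id_eq_one by (metis UNIV_I restrict_apply)

lemma act2_linear: "g \<in> carrier W \<Longrightarrow> linear (act2 g)"
  unfolding G_eq_carrier[symmetric]
proof (induction rule: G_induct)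
  case one
  then show ?case by (simp add: linear_iff act2_one)
next
  case (step i g)
  then show ?case
    by (simp add: linear_iff act2_mult r_closed G_closed action2_gen pair_simps algebra_simps)
qed

lemma pair_invariant: "g \<in> carrier W \<Longrightarrow> pair (act1 g x) (act2 g y) = pair x y"
  unfolding G_eq_carrier[symmetric]
proof (induction arbitrary: x y rule: G_induct)
  case one
  then show ?case by (simp add: act_one act2_one)
next
  case (step i g)
  have "pair (act1 (r i) x) (act2 (r i) y) = pair x y" for x y
    using step(1) by (simp add: act_r action2_gen pair_simps pair_self algebra_simps)
  then show ?case using step by (simp add: act_mult act2_mult r_closed G_closed)
qed

text \<open>Lets identities in \<open>W\<close> be verified by computing on the first space.\<close>

lemma faithful_eq:
  assumes "g \<in> carrier W" "h \<in> carrier W" "\<And>z. act1 g z = act1 h z"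
  shows "g = h"
proof -
  have "act1 (inv h \<otimes> g) z = z" for z
    using assms by (simp add: act_mult act_inv_cancel)
  then have "inv h \<otimes> g = \<one>"
    using assms by (intro faithful) (auto simp: G_eq_carrier)
  then show ?thesis using assms by (metis inv_closed inv_equality inv_inv)
qed

section \<open>Roots and their reflections\<close>

abbreviation \<Phi> :: "'v1 set" where "\<Phi> \<equiv> roots W S act1 \<alpha>"
abbreviation refl :: "'v1 \<Rightarrow> 'w" where "refl \<equiv> root_reflection W S r act1 \<alpha>"
abbreviation Pos :: "'v1 set" where "Pos \<equiv> PLC (\<alpha> ` S)"

lemma root_E:
  assumes "x \<in> \<Phi>"
  obtains w s where "w \<in> carrier W" "s \<in> S" "x = act1 w (\<alpha> s)"
  using assms unfolding roots_def by blast

lemma root_I: "w \<in> carrier W \<Longrightarrow> s \<in> S \<Longrightarrow> act1 w (\<alpha> s) \<in> \<Phi>"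
  unfolding roots_def by blast

lemma simple_root: "s \<in> S \<Longrightarrow> \<alpha> s \<in> \<Phi>"
  using root_I[of \<one> s] by (simp add: act_one)

lemma act_root: "x \<in> \<Phi> \<Longrightarrow> g \<in> carrier W \<Longrightarrow> act1 g x \<in> \<Phi>"
  by (metis root_E root_I act_mult m_closed)

lemma phi_root: "w \<in> carrier W \<Longrightarrow> s \<in> S \<Longrightarrow> \<phi> (act1 w (\<alpha> s)) = act2 w (\<beta> s)"
  using phi_equivariant simple_root phi_simple by simp

text \<open>The right side mentions \<open>w\<close> and \<open>s\<close> only through the root
  \<open>act1 w (\<alpha> s)\<close>; this is why the reflection of a root is well defined.\<close>

lemma act1_conj:
  assumes "w \<in> carrier W" "s \<in> S"
  shows "act1 (w \<otimes> r s \<otimes> inv w) z = z - (2 * pair z (\<phi> (act1 w (\<alpha> s)))) *\<^sub>R act1 w (\<alpha> s)"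
proof -
  have "pair (act1 (inv w) z) (\<beta> s) = pair z (\<phi> (act1 w (\<alpha> s)))"
    using pair_invariant[OF assms(1), of "act1 (inv w) z" "\<beta> s"] assms act_inv_cancel(2)
    by (simp add: phi_root)
  then show ?thesis
    using assms act1_linear[OF assms(1)]
    by (simp add: act_mult r_closed act_r linear_diff linear_scale act_inv_cancel)
qed

lemma act2_conj:
  assumes "w \<in> carrier W" "s \<in> S"
  shows "act2 (w \<otimes> r s \<otimes> inv w) z = z - (2 * pair (act1 w (\<alpha> s)) z) *\<^sub>R \<phi> (act1 w (\<alpha> s))"
proof -
  have c: "act2 w (act2 (inv w) z) = z"
    using act2_mult[of w "inv w" z] assms act2_one by simp
  have "pair (\<alpha> s) (act2 (inv w) z) = pair (act1 w (\<alpha> s)) z"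
    using pair_invariant[OF assms(1), of "\<alpha> s" "act2 (inv w) z"] c by simp
  then show ?thesis
    using assms act2_linear[OF assms(1)] c
    by (simp add: act2_mult r_closed action2_gen linear_diff linear_scale phi_root)
qed

text \<open>Two presentations of one root give conjugates with the same action, which are equal by
  faithfulness.\<close>

lemma refl_eq:
  assumes "w \<in> carrier W" "s \<in> S"
  shows "refl (act1 w (\<alpha> s)) = w \<otimes> r s \<otimes> inv w"
  unfolding root_reflection_def
proof (rule the_equality)
  show "\<exists>v\<in>carrier W. \<exists>t\<in>S. act1 w (\<alpha> s) = act1 v (\<alpha> t) \<and> w \<otimes> r s \<otimes> inv w = v \<otimes> r t \<otimes> inv v"
    using assms by blast
next
  fix g assume "\<exists>v\<in>carrier W. \<exists>t\<in>S. act1 w (\<alpha> s) = act1 v (\<alpha> t) \<and> g = v \<otimes> r t \<otimes> inv v"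
  then obtain v t where v: "v \<in> carrier W" "t \<in> S" "act1 w (\<alpha> s) = act1 v (\<alpha> t)" "g = v \<otimes> r t \<otimes> inv v"
    by blast
  show "g = w \<otimes> r s \<otimes> inv w"
    using v assms by (intro faithful_eq) (auto simp: r_closed act1_conj)
qed

lemma refl_closed: "x \<in> \<Phi> \<Longrightarrow> refl x \<in> carrier W"
  by (elim root_E) (simp add: refl_eq r_closed)

lemma act1_refl: "x \<in> \<Phi> \<Longrightarrow> act1 (refl x) z = z - (2 * pair z (\<phi> x)) *\<^sub>R x"
  by (elim root_E) (simp add: refl_eq act1_conj)

lemma act2_refl: "x \<in> \<Phi> \<Longrightarrow> act2 (refl x) z = z - (2 * pair x z) *\<^sub>R \<phi> x"
  by (elim root_E) (simp add: refl_eq act2_conj)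

lemma pair_root_self: "x \<in> \<Phi> \<Longrightarrow> pair x (\<phi> x) = 1"
  by (elim root_E) (simp add: phi_root pair_invariant pair_self)

lemma act1_refl_self: "x \<in> \<Phi> \<Longrightarrow> act1 (refl x) x = - x"
  by (simp add: act1_refl pair_root_self scaleR_2)

lemma root_nonzero: "x \<in> \<Phi> \<Longrightarrow> x \<noteq> 0"
  using pair_root_self[of x] by (auto simp: pair_simps)

lemma refl_act:
  assumes "x \<in> \<Phi>" "g \<in> carrier W"
  shows "refl (act1 g x) = g \<otimes> refl x \<otimes> inv g"
proof -
  obtain w s where w: "w \<in> carrier W" "s \<in> S" "x = act1 w (\<alpha> s)" using assms(1) by (rule root_E)
  have "refl (act1 g x) = refl (act1 (g \<otimes> w) (\<alpha> s))"
    using w assms by (simp add: act_mult)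
  also have "\<dots> = g \<otimes> (w \<otimes> r s \<otimes> inv w) \<otimes> inv g"
    using w assms by (subst refl_eq) (auto simp: r_closed inv_mult_group m_assoc)
  finally show ?thesis using w by (simp add: refl_eq)
qed

lemma refl_sq: "x \<in> \<Phi> \<Longrightarrow> refl x \<otimes> refl x = \<one>"
  using act1_refl_self act1_linear
  by (intro faithful_eq) (auto simp: refl_closed act_mult act_one act1_refl pair_simps pair_root_self)

lemma inv_refl: "x \<in> \<Phi> \<Longrightarrow> inv (refl x) = refl x"
  using refl_sq refl_closed by (simp add: inv_equality)

lemma neg_root: "x \<in> \<Phi> \<Longrightarrow> - x \<in> \<Phi>"
  using act_root[of x "refl x"] act1_refl_self refl_closed by simp

lemma refl_neg: "x \<in> \<Phi> \<Longrightarrow> refl (- x) = refl x"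
  using refl_act[of x "refl x"] act1_refl_self refl_closed
  by (simp add: m_assoc)

lemma reflections_eq: "reflections W S r = refl ` \<Phi>"
  unfolding reflections_def by (force simp: refl_eq root_I elim!: root_E intro: rev_image_eqI[OF root_I])

text \<open>For the root \<open>act1 w (\<alpha> s)\<close> the sign is decided by comparing the
  lengths of \<open>w\<close> and \<open>w \<otimes> r s\<close>.\<close>

lemma pos_or_neg: "x \<in> \<Phi> \<Longrightarrow> x \<in> Pos \<or> - x \<in> Pos"
  using act_in_PLC act_neg_in_PLC G_eq_carrier by (elim root_E) (metis linorder_not_less)

lemma not_pos_and_neg: "x \<in> Pos \<Longrightarrow> - x \<notin> Pos"
  using PLC_add[of x "\<alpha> ` S" "- x"] zero_notin by auto

text \<open>A product of reflections in two proportional roots moves every simple root only along one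
  line, so it keeps the simple roots positive.\<close>

lemma refl_multiple_simple:
  assumes y: "y \<in> \<Phi>" "y = c *\<^sub>R \<alpha> s" and s: "s \<in> S"
  shows "refl y = r s"
proof -
  have g: "refl y \<otimes> r s \<in> G" using y s by (simp add: G_eq_carrier refl_closed r_closed)
  have "refl y \<otimes> r s = \<one>"
  proof (rule eq_one_if_simple_positive[OF g])
    fix j assume j: "j \<in> S"
    define K where "K = 2 * pair (\<alpha> j) (\<beta> s) + 2 * pair (act1 (r s) (\<alpha> j)) (\<phi> y) * c"
    have "act1 (refl y \<otimes> r s) (\<alpha> j) = act1 (r s) (\<alpha> j) - (2 * pair (act1 (r s) (\<alpha> j)) (\<phi> y)) *\<^sub>R y"
      using y(1) s by (simp only: act_mult refl_closed r_closed act1_refl)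
    then have K: "act1 (refl y \<otimes> r s) (\<alpha> j) = \<alpha> j - K *\<^sub>R \<alpha> s"
      using s by (simp add: K_def y(2) act_r scaleR_add_left)
    show "- act1 (refl y \<otimes> r s) (\<alpha> j) \<notin> Pos"
    proof (cases "j = s")
      case True
      have "c \<noteq> 0" using y root_nonzero[OF y(1)] by auto
      have "c *\<^sub>R act1 (refl y) (\<alpha> s) = c *\<^sub>R - \<alpha> s"
        using act1_refl_self[OF y(1)] act1_linear[OF refl_closed[OF y(1)]]
        unfolding y(2) by (simp add: linear_scale)
      then have "act1 (refl y) (\<alpha> s) = - \<alpha> s" using \<open>c \<noteq> 0\<close> scaleR_cancel_left by metis
      then have "act1 (refl y \<otimes> r s) (\<alpha> j) = \<alpha> s"
        using act1_linear[OF refl_closed[OF y(1)]] s y(1) True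
        by (simp add: act_mult refl_closed r_closed act_r pair_self scaleR_2 linear_neg)
      then show ?thesis using s not_pos_and_neg[of "\<alpha> s"] by (simp add: PLC_base)
    next
      case False
      show ?thesis
      proof
        \<comment> \<open>This vector and \<open>\<alpha> j\<close> add up to
          \<open>K *\<^sub>R \<alpha> s\<close>, so extremality makes \<open>\<alpha> j\<close> a
          positive multiple of \<open>\<alpha> s\<close>; pairing with \<open>\<beta> s\<close>
          refutes that.\<close>
        assume "- act1 (refl y \<otimes> r s) (\<alpha> j) \<in> Pos"
        then obtain d where "d > 0" "\<alpha> j = d *\<^sub>R \<alpha> s"
          using j s K by (elim PLC_eq_simple[of "\<alpha> j" _ s K, rotated]) (auto simp: PLC_base)
        then show False using pair_nonpos[OF j s False] pair_self[OF s] by (simp add: pair_simps)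
      qed
    qed
  qed
  then show ?thesis
    using y s refl_closed r_closed inv_r by (metis inv_equality inv_inv)
qed

lemma refl_multiple:
  assumes "x \<in> \<Phi>" "y \<in> \<Phi>" "y = c *\<^sub>R x"
  shows "refl y = refl x"
proof -
  obtain w s where w: "w \<in> carrier W" "s \<in> S" "x = act1 w (\<alpha> s)" using assms(1) by (rule root_E)
  have "act1 (inv w) y = c *\<^sub>R \<alpha> s"
    using w assms act1_linear[of "inv w"] by (simp add: linear_scale act_inv_cancel)
  then have "refl (act1 (inv w) y) = r s"
    using w act_root[OF assms(2), of "inv w"] by (intro refl_multiple_simple[of _ c]) auto
  then have "refl (act1 w (act1 (inv w) y)) = w \<otimes> r s \<otimes> inv w"
    using w assms(2) act_root by (subst refl_act) auto
  then show ?thesis using w by (simp add: refl_eq act_inv_cancel)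
qed

text \<open>Evaluating the common reflection at \<open>x\<close>, and at \<open>\<phi> x\<close> on
  the second space, gives the factors.\<close>

lemma refl_eq_imp_multiple:
  assumes "x \<in> \<Phi>" "y \<in> \<Phi>" "refl x = refl y"
  shows "x = pair x (\<phi> y) *\<^sub>R y" "\<phi> x = pair y (\<phi> x) *\<^sub>R \<phi> y"
proof -
  have "- x = x - (2 * pair x (\<phi> y)) *\<^sub>R y"
    using act1_refl_self[OF assms(1)] act1_refl[OF assms(2), of x] assms(3) by simp
  then have "2 *\<^sub>R x = 2 *\<^sub>R (pair x (\<phi> y) *\<^sub>R y)"
    by (simp add: scaleR_2 algebra_simps)
  then show "x = pair x (\<phi> y) *\<^sub>R y" by (simp only: scaleR_cancel_left) simp
  have "act2 (refl x) (\<phi> x) = - \<phi> x"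
    using assms(1) by (simp add: act2_refl pair_root_self scaleR_2)
  then have "- \<phi> x = \<phi> x - (2 * pair y (\<phi> x)) *\<^sub>R \<phi> y"
    using act2_refl[OF assms(2), of "\<phi> x"] assms(3) by simp
  then have "2 *\<^sub>R \<phi> x = 2 *\<^sub>R (pair y (\<phi> x) *\<^sub>R \<phi> y)"
    by (simp add: scaleR_2 algebra_simps)
  then show "\<phi> x = pair y (\<phi> x) *\<^sub>R \<phi> y" by (simp only: scaleR_cancel_left) simp
qed

subsection \<open>Inversions and canonical generators\<close>

text \<open>Applying the letters from right to left, the image of \<open>y\<close> turns negative at
  some letter. Just before, it is a multiple of that simple root, so multiplying by
  \<open>refl y\<close> deletes the letter.\<close>

lemma strong_exchange_word:
  assumes "u \<in> lists S" "y \<in> \<Phi>" "y \<in> Pos" "- act1 (val u) y \<in> Pos"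
  shows "\<exists>u'\<in>lists S. length u' < length u \<and> val u' = val u \<otimes> refl y"
  using assms
proof (induction u)
  case Nil
  then show ?case using not_pos_and_neg by (simp add: act_one)
next
  case (Cons s u)
  then have s: "s \<in> S" "u \<in> lists S" by auto
  define z where "z = act1 (val u) y"
  have z: "z \<in> \<Phi>" unfolding z_def by (rule act_root[OF Cons.prems(1) val_closed[OF s(2)]])
  show ?case
  proof (cases "z \<in> Pos")
    case False
    then obtain u' where "u' \<in> lists S" "length u' < length u" "val u' = val u \<otimes> refl y"
      using Cons.IH[OF Cons.prems(1,2)] pos_or_neg[OF z] z_def by auto
    then show ?thesis
      using s Cons.prems(1)
      by (intro bexI[of _ "s # u'"]) (auto simp: m_assoc r_closed val_closed refl_closed)
  next
    case True
    have "- act1 (r s) z \<in> Pos"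
      using Cons.prems s by (simp add: z_def act_mult r_closed val_closed)
    then obtain c where "z = c *\<^sub>R \<alpha> s" using reflection_sign_change[OF True _ s(1)] by blast
    then have "refl z = r s" using refl_multiple_simple z s by simp
    then have "val u \<otimes> refl y \<otimes> inv (val u) = r s"
      using refl_act[OF Cons.prems(1) val_closed[OF s(2)]] z_def by simp
    then have "val u \<otimes> refl y = r s \<otimes> val u"
      using inv_solve_right' refl_closed[OF Cons.prems(1)] val_closed[OF s(2)] r_closed[OF s(1)]
      by (metis m_closed)
    then have "val (s # u) \<otimes> refl y = r s \<otimes> (r s \<otimes> val u)"
      using val_closed[OF s(2)] refl_closed[OF Cons.prems(1)] r_closed[OF s(1)] by (simp add: m_assoc)
    also have "\<dots> = val u"
      using val_closed[OF s(2)] r_closed[OF s(1)] r_sq[OF s(1)] by (simp flip: m_assoc)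
    finally show ?thesis using s by (intro bexI[of _ u]) auto
  qed
qed

lemma strong_exchange:
  assumes "w \<in> carrier W" "y \<in> \<Phi>" "y \<in> Pos" "- act1 w y \<in> Pos"
  shows "len (w \<otimes> refl y) < len w"
proof -
  obtain u where u: "u \<in> lists S" "length u = len w" "val u = w"
    using reduced_word assms(1) G_eq_carrier by blast
  then show ?thesis
    using strong_exchange_word[OF u(1) assms(2,3)] assms(4) len_le by fastforce
qed

text \<open>For the converse, if \<open>w\<close> keeps \<open>y\<close> positive then
  \<open>w \<otimes> refl y\<close> makes it negative, and strong exchange applied to that product
  reverses the length inequality.\<close>

lemma Nbar_iff:
  assumes "w \<in> carrier W" "y \<in> \<Phi>" "y \<in> Pos"
  shows "refl y \<in> Nbar W S r w \<longleftrightarrow> - act1 w y \<in> Pos"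
proof
  assume "- act1 w y \<in> Pos"
  then show "refl y \<in> Nbar W S r w"
    using strong_exchange assms by (simp add: Nbar_def reflections_eq)
next
  assume "refl y \<in> Nbar W S r w"
  then have lt: "len (w \<otimes> refl y) < len w" by (simp add: Nbar_def)
  show "- act1 w y \<in> Pos"
  proof (rule ccontr)
    assume "- act1 w y \<notin> Pos"
    then have "act1 w y \<in> Pos" using pos_or_neg act_root assms by blast
    moreover have "- act1 (w \<otimes> refl y) y = act1 w y"
      using assms act1_linear[OF assms(1)] by (simp add: act_mult refl_closed act1_refl_self linear_neg)
    ultimately have "len (w \<otimes> refl y \<otimes> refl y) < len (w \<otimes> refl y)"
      using assms by (intro strong_exchange) (auto simp: refl_closed)
    moreover have "w \<otimes> refl y \<otimes> refl y = w"
      using assms by (simp add: m_assoc refl_closed refl_sq)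
    ultimately show False using lt by simp
  qed
qed

section \<open>The order of a product of two reflections\<close>

text \<open>If \<open>refl y\<close> fixes \<open>x\<close>, the two reflections commute, so
  \<open>refl x\<close> maps \<open>y\<close> to a multiple of \<open>y\<close>. Pairing with
  \<open>\<phi> y\<close> shows that the factor is 1.\<close>

lemma pair_roots_zero:
  assumes "x \<in> \<Phi>" "y \<in> \<Phi>" "pair x (\<phi> y) = 0"
  shows "pair y (\<phi> x) = 0"
proof -
  have x: "refl x \<in> carrier W" and y: "refl y \<in> carrier W" using assms refl_closed by auto
  have "act1 (refl y) x = x" using assms by (simp add: act1_refl)
  then have "refl x = refl y \<otimes> refl x \<otimes> refl y"
    using refl_act[OF assms(1) y] inv_refl[OF assms(2)] by simp
  then have "refl x \<otimes> refl y = refl y \<otimes> refl x"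
    using x y refl_sq[OF assms(2)] by (metis m_assoc m_closed r_one)
  then have "refl (act1 (refl x) y) = refl y"
    using refl_act[OF assms(2) x] inv_refl[OF assms(1)] x y refl_sq[OF assms(1)] by (simp add: m_assoc)
  then obtain c where c: "act1 (refl x) y = c *\<^sub>R y"
    using refl_eq_imp_multiple(1) act_root assms x by metis
  then have e: "y - (2 * pair y (\<phi> x)) *\<^sub>R x = c *\<^sub>R y" using act1_refl assms by simp
  then have "pair (y - (2 * pair y (\<phi> x)) *\<^sub>R x) (\<phi> y) = pair (c *\<^sub>R y) (\<phi> y)" by simp
  then have "c = 1" using assms(3) pair_root_self[OF assms(2)] by (simp add: pair_simps)
  then show ?thesis using e root_nonzero[OF assms(1)] by simp
qed

lemma act_power_orbit:
  assumes g: "g \<in> carrier W" and step: "\<And>t. act1 g (E t) = E (t + d)"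
  shows "act1 (g [^] (k::nat)) (E t) = E (t + real k * d)"
proof (induction k arbitrary: t)
  case 0
  then show ?case by (simp add: act_one)
next
  case (Suc k)
  then show ?case using g step by (simp add: act_mult algebra_simps)
qed

lemma act_power_fixed:
  assumes g: "g \<in> carrier W" "act1 g z = z"
  shows "act1 (g [^] (k::nat)) z = z"
  using act_power_orbit[of g "\<lambda>_. z" 0 k 0] assms by simp

text \<open>In the plane spanned by \<open>x\<close> and \<open>y\<close> the product of the reflections is a rotation by
  \<open>2 \<pi> / m\<close>, with orbits \<open>E t, E (t + 2 \<theta>), \<dots>\<close>; the common kernel of \<open>\<phi> x\<close> and \<open>\<phi> y\<close> is
  fixed, and the two subspaces span since the Gram determinant is \<open>sin\<^sup>2 \<theta>\<close>.\<close>

lemma refl_product_power: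
  assumes x: "x \<in> \<Phi>" and y: "y \<in> \<Phi>" and np: "pair x (\<phi> y) \<le> 0" "pair y (\<phi> x) \<le> 0"
    and m: "2 \<le> m" "pair x (\<phi> y) * pair y (\<phi> x) = (cos (pi / real m))\<^sup>2"
  shows "(refl x \<otimes> refl y) [^] m = \<one>"
proof -
  define \<theta> where "\<theta> = pi / real m"
  have "0 \<le> - pair x (\<phi> y)" "0 \<le> - pair y (\<phi> x)" "- pair x (\<phi> y) = 0 \<longleftrightarrow> - pair y (\<phi> x) = 0"
    using np pair_roots_zero[OF x y] pair_roots_zero[OF y x] by auto
  then obtain \<kappa> \<mu> where \<mu>: "\<mu> > 0" "\<kappa> \<ge> 0" and e: "- pair x (\<phi> y) = \<kappa> * \<mu>" "- pair y (\<phi> x) = \<kappa> / \<mu>"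
      and sq: "\<kappa>\<^sup>2 = (- pair x (\<phi> y)) * (- pair y (\<phi> x))"
    by (rule symmetrize)
  have c: "pair x (\<phi> y) = - (\<kappa> * \<mu>)" "pair y (\<phi> x) = - (\<kappa> / \<mu>)" using e by linarith+
  have "0 \<le> cos \<theta>" unfolding \<theta>_def using m(1) by (rule cos_pi_div_nonneg)
  then have \<kappa>: "\<kappa> = cos \<theta>" using sq m(2) \<mu>(2) unfolding \<theta>_def by (simp add: power2_eq_imp_eq)
  have s: "sin \<theta> > 0"
    unfolding \<theta>_def using m(1) by (intro sin_gt_zero) (auto simp: field_simps)
  define g where "g = refl x \<otimes> refl y"
  have g: "g \<in> carrier W" unfolding g_def using x y refl_closed by simp
  have gz: "act1 g z = act1 (refl x) (act1 (refl y) z)" for z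
    unfolding g_def using x y refl_closed by (simp add: act_mult)
  \<comment> \<open>The samples at \<open>t = 0\<close> and at \<open>t = - \<theta>\<close> are
    nonzero multiples of \<open>x\<close> and of \<open>y\<close>, so fixing the curve pointwise
    fixes both roots.\<close>
  define E where "E t = sin (t + \<theta>) *\<^sub>R x + (\<mu> * sin t) *\<^sub>R y" for t
  have rot: "2 * (\<kappa> * sin (t + \<theta>)) = sin t + sin (t + 2 * \<theta>)" for t
  proof -
    have "sin t = sin ((t + \<theta>) - \<theta>)" "sin (t + 2 * \<theta>) = sin ((t + \<theta>) + \<theta>)" by (simp_all add: algebra_simps)
    then show ?thesis unfolding \<kappa>
      by (simp only: sin_add[of "t + \<theta>"] sin_diff[of "t + \<theta>"]) (simp add: mult.commute)
  qed
  have ry: "act1 (refl y) (E t) = sin (t + \<theta>) *\<^sub>R x + (\<mu> * sin (t + 2 * \<theta>)) *\<^sub>R y" for t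
  proof -
    have "pair (E t) (\<phi> y) = \<mu> * sin t - \<mu> * (\<kappa> * sin (t + \<theta>))"
      unfolding E_def by (simp add: pair_simps c pair_root_self[OF y])
    then have "\<mu> * sin t - 2 * pair (E t) (\<phi> y) = \<mu> * (2 * (\<kappa> * sin (t + \<theta>)) - sin t)"
      by (simp add: algebra_simps)
    also have "\<dots> = \<mu> * sin (t + 2 * \<theta>)" unfolding rot by simp
    finally show ?thesis
      unfolding act1_refl[OF y] by (simp add: E_def algebra_simps flip: scaleR_add_left scaleR_diff_left)
  qed
  have step: "act1 g (E t) = E (t + 2 * \<theta>)" for t
  proof -
    let ?v = "sin (t + \<theta>) *\<^sub>R x + (\<mu> * sin (t + 2 * \<theta>)) *\<^sub>R y"
    have "pair ?v (\<phi> x) = sin (t + \<theta>) - \<kappa> * sin (t + \<theta> + \<theta>)"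
      using \<mu>(1) by (simp add: pair_simps c pair_root_self[OF x] algebra_simps)
    then have "sin (t + \<theta>) - 2 * pair ?v (\<phi> x) = sin (t + \<theta> + 2 * \<theta>)"
      using rot[of "t + \<theta>"] by linarith
    moreover have "act1 g (E t) = (sin (t + \<theta>) - 2 * pair ?v (\<phi> x)) *\<^sub>R x + (\<mu> * sin (t + 2 * \<theta>)) *\<^sub>R y"
      unfolding gz ry act1_refl[OF x] by (simp add: scaleR_diff_left)
    ultimately have "act1 g (E t) = sin (t + \<theta> + 2 * \<theta>) *\<^sub>R x + (\<mu> * sin (t + 2 * \<theta>)) *\<^sub>R y"
      by (simp only:)
    moreover have "t + \<theta> + 2 * \<theta> = t + 2 * \<theta> + \<theta>" by simp
    ultimately show ?thesis by (simp only: E_def)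
  qed
  have lin: "linear (act1 (g [^] m))" using g by (intro act1_linear) simp
  have period: "real m * (2 * \<theta>) = 2 * pi" using m(1) by (simp add: \<theta>_def)
  have fixE: "act1 (g [^] m) (E t) = E t" for t
  proof -
    have "sin (t + 2 * pi + \<theta>) = sin (t + \<theta> + 2 * pi)" by (simp only: ac_simps)
    then have "E (t + 2 * pi) = E t"
      unfolding E_def by (simp only: sin_periodic)
    then show ?thesis
      using act_power_orbit[of g E "2 * \<theta>" m t, OF g step] by (simp only: period)
  qed
  have "E 0 = sin \<theta> *\<^sub>R x" "E (- \<theta>) = (- \<mu> * sin \<theta>) *\<^sub>R y" by (simp_all add: E_def)
  then have "act1 (g [^] m) (sin \<theta> *\<^sub>R x) = sin \<theta> *\<^sub>R x"
      "act1 (g [^] m) ((- \<mu> * sin \<theta>) *\<^sub>R y) = (- \<mu> * sin \<theta>) *\<^sub>R y"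
    using fixE by metis+
  then have fixed: "act1 (g [^] m) x = x" "act1 (g [^] m) y = y"
    using s \<mu>(1) unfolding linear_scale[OF lin] scaleR_cancel_left by auto
  have "act1 (g [^] m) z = z" for z
  proof -
    define u v where "u = pair z (\<phi> x)" and "v = pair z (\<phi> y)"
    define D where "D = 1 - \<kappa>\<^sup>2"
    have D: "D > 0" unfolding D_def \<kappa> using s sin_cos_squared_add[of \<theta>] zero_less_power[of "sin \<theta>" 2] by linarith
    \<comment> \<open>Cramer's rule: these coefficients make \<open>z0\<close> vanish under both
      \<open>\<phi> x\<close> and \<open>\<phi> y\<close>.\<close>
    define p q where "p = (u + \<kappa> / \<mu> * v) / D" and "q = (v + \<kappa> * \<mu> * u) / D"
    define z0 where "z0 = z - p *\<^sub>R x - q *\<^sub>R y"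
    have pq: "D * p = u + \<kappa> / \<mu> * v" "D * q = v + \<kappa> * \<mu> * u" using D by (simp_all add: p_def q_def)
    have "D * (p - \<kappa> / \<mu> * q) = D * u" "D * (q - \<kappa> * \<mu> * p) = D * v"
    proof -
      have "D * (p - \<kappa> / \<mu> * q) = D * p - \<kappa> / \<mu> * (D * q)" "D * (q - \<kappa> * \<mu> * p) = D * q - \<kappa> * \<mu> * (D * p)"
        by (simp_all add: algebra_simps)
      then show "D * (p - \<kappa> / \<mu> * q) = D * u" "D * (q - \<kappa> * \<mu> * p) = D * v"
        unfolding pq using \<mu>(1) by (simp_all add: D_def power2_eq_square algebra_simps)
    qed
    then have "p - \<kappa> / \<mu> * q = u" "q - \<kappa> * \<mu> * p = v" using D by simp_all
    then have "pair z0 (\<phi> x) = 0" "pair z0 (\<phi> y) = 0"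
      by (auto simp: z0_def u_def v_def pair_simps c pair_root_self[OF x] pair_root_self[OF y] algebra_simps)
    then have "act1 g z0 = z0" unfolding gz by (simp add: act1_refl x y)
    then have z0: "act1 (g [^] m) z0 = z0" using act_power_fixed g by blast
    have "act1 (g [^] m) (z0 + p *\<^sub>R x + q *\<^sub>R y) = z0 + p *\<^sub>R x + q *\<^sub>R y"
      by (simp only: linear_add[OF lin] linear_scale[OF lin] z0 fixed)
    then show ?thesis by (simp add: z0_def)
  qed
  then show ?thesis using g by (intro faithful) (auto simp: G_eq_carrier g_def)
qed

lemma canonical_generators_eq:
  assumes sub: "\<Delta> \<subseteq> \<Phi> \<inter> Pos"
    and nonpos: "\<And>x x'. x \<in> \<Delta> \<Longrightarrow> x' \<in> \<Delta> \<Longrightarrow> x \<noteq> x' \<Longrightarrow> pair x (\<phi> x') \<le> 0"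
    and prod: "\<And>x x'. x \<in> \<Delta> \<Longrightarrow> x' \<in> \<Delta> \<Longrightarrow> refl x \<noteq> refl x' \<Longrightarrow>
        pair x (\<phi> x') * pair x' (\<phi> x) \<in> {(cos (pi / real m))\<^sup>2 | m :: nat. m \<ge> 2} \<union> {1..}"
  shows "canonical_generators W S r (generate W (refl ` \<Delta>)) = refl ` \<Delta>"
proof -
  have \<Phi>: "x \<in> \<Phi>" and Pos: "x \<in> Pos" if "x \<in> \<Delta>" for x using sub that by auto
  have PLC: "PLC \<Delta> \<subseteq> Pos" using sub by (intro PLC_subset_PLC) auto
  \<comment> \<open>Equal reflections make \<open>x\<close> a multiple of \<open>x'\<close> by a
    nonzero factor that is at most 0, against positivity of both. Hence \<open>prod\<close> applies
    to all distinct pairs.\<close>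
  have inj: "refl x \<noteq> refl x'" if "x \<in> \<Delta>" "x' \<in> \<Delta>" "x \<noteq> x'" for x x'
  proof
    assume "refl x = refl x'"
    then have e: "x = pair x (\<phi> x') *\<^sub>R x'" using refl_eq_imp_multiple \<Phi> that by blast
    let ?k = "- pair x (\<phi> x')"
    have "?k \<noteq> 0" using e root_nonzero[OF \<Phi>[OF that(1)]] by auto
    then have "?k > 0" using nonpos[OF that] by linarith
    moreover have "- x = ?k *\<^sub>R x'" using arg_cong[OF e, of uminus] by simp
    ultimately have "- x \<in> Pos" using PLC_scale[OF Pos[OF that(2)]] by metis
    then show False using not_pos_and_neg Pos that(1) by blast
  qed
  interpret sub: reflection_rep W act1 pair \<Delta> refl "\<lambda>x. x" \<phi>
  proof (intro reflection_rep.intro action1 reflection_rep_axioms.intro)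
    show "bilinear pair" by (rule bilin)
    show "0 \<notin> PLC ((\<lambda>x. x) ` \<Delta>)" using PLC zero_notin by auto
    fix x assume x: "x \<in> \<Delta>"
    show "refl x \<in> carrier W" "refl x \<otimes> refl x = \<one>" "pair x (\<phi> x) = 1"
      "act1 (refl x) z = z - (2 * pair z (\<phi> x)) *\<^sub>R x" for z
      using \<Phi>[OF x] refl_closed refl_sq pair_root_self act1_refl by auto
    fix y assume y: "y \<in> \<Delta>" "x \<noteq> y"
    show "pair x (\<phi> y) \<le> 0" using nonpos x y by blast
    show "pair y (\<phi> x) = 0" if "pair x (\<phi> y) = 0"
      using pair_roots_zero[OF \<Phi>[OF x] \<Phi>[OF y(1)] that] .
    show "(\<exists>m::nat. m \<ge> 2 \<and> pair x (\<phi> y) * pair y (\<phi> x) = (cos (pi / real m))\<^sup>2 \<and> (refl x \<otimes> refl y) [^] m = \<one>) \<or>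
      pair x (\<phi> y) * pair y (\<phi> x) \<ge> 1"
      using prod[OF x y(1) inj[OF x y]] refl_product_power[OF \<Phi>[OF x] \<Phi>[OF y(1)]] nonpos x y
      by auto
  qed
  let ?H = "generate W (refl ` \<Delta>)"
  have H: "?H = sub.G" by (rule sub.generate_eq_G)
  have cone: "y \<in> PLC \<Delta>" if y: "y \<in> \<Phi>" "y \<in> Pos" "refl y \<in> sub.G" for y
  proof -
    have "refl y \<noteq> \<one>"
    proof
      assume "refl y = \<one>"
      then have "y = - y" using act1_refl_self[OF y(1)] by (simp add: act_one)
      then show False using y(2) not_pos_and_neg by metis
    qed
    then obtain x where x: "x \<in> \<Delta>" "sub.len (refl y \<otimes> refl x) < sub.len (refl y)"
      using sub.exists_descent y(3) by blast
    define k where "k = 2 * pair x (\<phi> y)"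
    have "- act1 (refl y) x \<in> PLC \<Delta>"
      using sub.act_neg_in_PLC[OF y(3) x] by simp
    then have "- act1 (refl y) x + x \<in> PLC \<Delta>" by (rule PLC_add[OF _ PLC_base[OF x(1)]])
    moreover have "- act1 (refl y) x + x = k *\<^sub>R y" using y(1) by (simp add: k_def act1_refl)
    ultimately have ky: "k *\<^sub>R y \<in> PLC \<Delta>" by simp
    have "k > 0"
    proof (rule ccontr)
      assume "\<not> k > 0"
      moreover have "k \<noteq> 0" using ky PLC zero_notin by auto
      ultimately have "- (k *\<^sub>R y) \<in> Pos" using PLC_scale[OF y(2), of "- k"] by simp
      then show False using ky PLC not_pos_and_neg by blast
    qed
    then show ?thesis using PLC_scale[OF ky, of "1 / k"] by simp
  qed
  have unique: "refl y = refl x"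
    if x: "x \<in> \<Delta>" and y: "y \<in> \<Phi>" "y \<in> Pos" "refl y \<in> sub.G" "- act1 (refl x) y \<in> Pos" for x y
  proof -
    have cl: "refl x \<in> carrier W" using x \<Phi> refl_closed by blast
    \<comment> \<open>This is again a positive root with reflection in the subgroup, so
      \<open>cone\<close> applies to it as well as to \<open>y\<close>, and the sign change takes
      place within the smaller cone.\<close>
    have "- act1 (refl x) y \<in> PLC \<Delta>"
    proof (rule cone)
      show "- act1 (refl x) y \<in> \<Phi>" using neg_root act_root y(1) cl by blast
      have "refl (- act1 (refl x) y) = refl x \<otimes> refl y \<otimes> inv (refl x)"
        using refl_neg refl_act act_root y(1) cl by simp
      then show "refl (- act1 (refl x) y) \<in> sub.G"
        using sub.mult_G sub.inv_G sub.r_G[OF x] y(3) by simp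
    qed (rule y(4))
    moreover have "y \<in> PLC \<Delta>" using cone y by blast
    ultimately obtain c where "y = c *\<^sub>R x"
      using sub.reflection_sign_change[of y x] x by auto
    then show ?thesis using refl_multiple \<Phi> x y by blast
  qed
  show ?thesis
  proof
    show "refl ` \<Delta> \<subseteq> canonical_generators W S r ?H"
    proof
      fix t assume "t \<in> refl ` \<Delta>"
      then obtain x where x: "x \<in> \<Delta>" "t = refl x" by blast
      have tx: "t \<in> carrier W" using x \<Phi> refl_closed by simp
      have "t \<in> Nbar W S r t"
        using Nbar_iff[OF tx \<Phi>[OF x(1)] Pos[OF x(1)]] x act1_refl_self \<Phi> Pos by simp
      moreover have "t' = t" if t': "t' \<in> Nbar W S r t" "t' \<in> ?H" for t'
      proof -
        obtain y0 where y0: "y0 \<in> \<Phi>" "t' = refl y0" using t'(1) by (auto simp: Nbar_def reflections_eq)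
        \<comment> \<open>A root and its negative have the same reflection, so the positive one may
          be chosen.\<close>
        obtain y where y: "y \<in> \<Phi>" "t' = refl y" "y \<in> Pos"
          using y0 pos_or_neg[of y0] neg_root refl_neg by metis
        show ?thesis
          using unique[OF x(1) y(1,3)] Nbar_iff[OF tx y(1,3)] t' x y H by simp
      qed
      moreover have "t \<in> ?H" using x H sub.r_G by simp
      moreover have "t \<in> reflections W S r" using x \<Phi> by (simp add: reflections_eq)
      ultimately show "t \<in> canonical_generators W S r ?H"
        unfolding canonical_generators_def by blast
    qed
    show "canonical_generators W S r ?H \<subseteq> refl ` \<Delta>"
    proof
      fix t assume "t \<in> canonical_generators W S r ?H"
      then have t: "t \<in> reflections W S r" "Nbar W S r t \<inter> ?H = {t}"
        by (auto simp: canonical_generators_def)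
      then obtain y where y: "y \<in> \<Phi>" "t = refl y" by (auto simp: reflections_eq)
      have tG: "t \<in> sub.G" using t(2) H by blast
      have "t \<noteq> \<one>"
      proof
        assume "t = \<one>"
        then have "t \<notin> Nbar W S r t" by (simp add: Nbar_def)
        then show False using t(2) by blast
      qed
      then obtain x where x: "x \<in> \<Delta>" "sub.len (t \<otimes> refl x) < sub.len t"
        using sub.exists_descent tG by blast
      \<comment> \<open>A descent of \<open>t\<close> relative to \<open>\<Delta>\<close> is thereby
        an inversion of \<open>t\<close> in the whole group, and the only one in the subgroup is
        \<open>t\<close> itself.\<close>
      have "- act1 t x \<in> Pos" using sub.act_neg_in_PLC[OF tG x] PLC by auto
      then have "refl x \<in> Nbar W S r t"
        using Nbar_iff[OF _ \<Phi>[OF x(1)] Pos[OF x(1)]] y refl_closed by simp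
      then have "refl x = t" using t(2) sub.r_G[OF x(1)] H by blast
      then show "t \<in> refl ` \<Delta>" using x(1) by blast
    qed
  qed
qed

section \<open>Transfer to the second root system and comparison of rays\<close>

text \<open>Injectivity of \<open>\<phi>\<close> on roots carries every presentation of
  \<open>\<phi> x\<close> back to one of \<open>x\<close>.\<close>

lemma refl_phi:
  assumes "x \<in> \<Phi>"
  shows "root_reflection W S r act2 \<beta> (\<phi> x) = refl x"
  unfolding root_reflection_def[of W S r act2]
proof (rule the_equality)
  obtain w s where w: "w \<in> carrier W" "s \<in> S" "x = act1 w (\<alpha> s)" using assms by (rule root_E)
  then show "\<exists>w\<in>carrier W. \<exists>s\<in>S. \<phi> x = act2 w (\<beta> s) \<and> refl x = w \<otimes> r s \<otimes> inv w"
    using phi_root refl_eq by blast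
next
  fix t assume "\<exists>w\<in>carrier W. \<exists>s\<in>S. \<phi> x = act2 w (\<beta> s) \<and> t = w \<otimes> r s \<otimes> inv w"
  then obtain w s where w: "w \<in> carrier W" "s \<in> S" "\<phi> x = act2 w (\<beta> s)" "t = w \<otimes> r s \<otimes> inv w" by blast
  then have "\<phi> x = \<phi> (act1 w (\<alpha> s))" by (simp add: phi_root)
  then have "x = act1 w (\<alpha> s)"
    using assms root_I w phi_bij unfolding bij_betw_def by (meson inj_onD)
  then show "t = refl x" using w refl_eq by simp
qed

end

lemma hat_scaleR: "c \<noteq> 0 \<Longrightarrow> hat A (c *\<^sub>R z) = hat A z"
proof -
  assume c: "c \<noteq> 0"
  have "(\<exists>d. d \<noteq> 0 \<and> y = d *\<^sub>R c *\<^sub>R z) \<longleftrightarrow> (\<exists>d. d \<noteq> 0 \<and> y = d *\<^sub>R z)" for y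
  proof
    assume "\<exists>d. d \<noteq> 0 \<and> y = d *\<^sub>R z"
    then obtain d where "d \<noteq> 0" "y = d *\<^sub>R z" by blast
    then show "\<exists>d. d \<noteq> 0 \<and> y = d *\<^sub>R c *\<^sub>R z" using c by (intro exI[of _ "d / c"]) simp
  qed (use c in \<open>auto intro: exI[of _ "_ * c"]\<close>)
  then show ?thesis by (simp add: hat_def)
qed

theorem proposition3p15:
  fixes S :: "'s set"
    and pair :: "'v1::real_vector \<Rightarrow> 'v2::real_vector \<Rightarrow> real"
    and \<alpha> :: "'s \<Rightarrow> 'v1" and \<beta> :: "'s \<Rightarrow> 'v2"
    and W :: "('w, 'b) monoid_scheme" and r :: "'s \<Rightarrow> 'w"
    and act1 :: "'w \<Rightarrow> 'v1 \<Rightarrow> 'v1" and act2 :: "'w \<Rightarrow> 'v2 \<Rightarrow> 'v2"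
    and \<phi> :: "'v1 \<Rightarrow> 'v2"
    and \<Delta>1 :: "'v1 set" and \<Delta>2 :: "'v2 set"
  defines "\<Phi>1 \<equiv> roots W S act1 \<alpha>" and "\<Phi>2 \<equiv> roots W S act2 \<beta>"
    and "refl1 \<equiv> root_reflection W S r act1 \<alpha>"
  assumes datum: "coxeter_datum S pair \<alpha> \<beta>"
    and system: "coxeter_system W S r (coxeter_exponent pair \<alpha> \<beta>)"
    and action1: "group_action W UNIV act1"
    and action1_gen: "\<And>s x. s \<in> S \<Longrightarrow> act1 (r s) x = x - (2 * pair x (\<beta> s)) *\<^sub>R \<alpha> s"
    and action2: "group_action W UNIV act2"
    and action2_gen: "\<And>s y. s \<in> S \<Longrightarrow> act2 (r s) y = y - (2 * pair (\<alpha> s) y) *\<^sub>R \<beta> s"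
    and phi_bij: "bij_betw \<phi> \<Phi>1 \<Phi>2"
    and phi_equivariant: "\<And>w x. w \<in> carrier W \<Longrightarrow> x \<in> \<Phi>1 \<Longrightarrow> \<phi> (act1 w x) = act2 w (\<phi> x)"
    and phi_simple: "\<And>s. s \<in> S \<Longrightarrow> \<phi> (\<alpha> s) = \<beta> s"
    and sub1: "\<Delta>1 \<subseteq> positive_roots W S act1 \<alpha>"
    and sub2: "\<Delta>2 \<subseteq> positive_roots W S act2 \<beta>"
    and A1: "\<phi> ` \<Delta>1 = \<Delta>2"
    and A2: "\<And>x x'. x \<in> \<Delta>1 \<Longrightarrow> x' \<in> \<Delta>1 \<Longrightarrow> x \<noteq> x' \<Longrightarrow> pair x (\<phi> x') \<le> 0"
    and A3: "\<And>x x'. x \<in> \<Delta>1 \<Longrightarrow> x' \<in> \<Delta>1 \<Longrightarrow> refl1 x \<noteq> refl1 x' \<Longrightarrow>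
        pair x (\<phi> x') * pair x' (\<phi> x)
          \<in> {(cos (pi / real m))\<^sup>2 | m :: nat. m \<ge> 2} \<union> {1..}"
  shows "let W' = generate W (refl1 ` \<Delta>1) in
     reflection_subgroup W S r W' \<and>
     hat \<Phi>1 ` \<Delta>1 = hat \<Phi>1 ` canonical_roots W S r act1 \<alpha> W' \<and>
     hat \<Phi>2 ` \<Delta>2 = hat \<Phi>2 ` canonical_roots W S r act2 \<beta> W'"
proof -
  interpret coxeter_rep S pair \<alpha> \<beta> W r act1 act2 \<phi>
    using datum system action1 action1_gen action2 action2_gen phi_bij phi_equivariant phi_simple
    unfolding \<Phi>1_def \<Phi>2_def by (rule coxeter_rep.intro)
  define W' where "W' = generate W (refl1 ` \<Delta>1)"
  have D1: "\<Delta>1 \<subseteq> \<Phi>1" "\<Delta>1 \<subseteq> PLC (\<alpha> ` S)"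
    using sub1 by (auto simp: positive_roots_def \<Phi>1_def)
  have canonical: "canonical_generators W S r W' = refl1 ` \<Delta>1"
    unfolding W'_def refl1_def
    by (rule canonical_generators_eq)
      (use D1 A2 A3 in \<open>simp_all add: \<Phi>1_def refl1_def\<close>)
  have T: "refl1 ` \<Delta>1 \<subseteq> reflections W S r"
    using D1 unfolding reflections_eq refl1_def \<Phi>1_def by blast
  have C: "reflections W S r \<subseteq> carrier W"
    using refl_closed by (auto simp: reflections_eq)
  have subgroup: "subgroup W' W"
    unfolding W'_def using T C by (intro generate_is_subgroup) blast
  have "refl1 ` \<Delta>1 \<subseteq> W' \<inter> reflections W S r"
    using T by (auto simp: W'_def intro: generate.incl)
  then have "W' \<subseteq> generate W (W' \<inter> reflections W S r)"
    unfolding W'_def by (rule mono_generate)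
  moreover have "generate W (W' \<inter> reflections W S r) \<subseteq> W'"
    using subgroup by (intro generate_subgroup_incl) auto
  ultimately have reflection_subgroup: "reflection_subgroup W S r W'"
    using subgroup by (auto simp: reflection_subgroup_def)
  \<comment> \<open>Once the canonical generators are known, canonical roots need only be matched
    with elements of \<open>\<Delta>1\<close> having the same reflection; such roots are
    proportional on both sides.\<close>
  have hat1: "hat \<Phi>1 x = hat \<Phi>1 y" and hat2: "hat \<Phi>2 (\<phi> x) = hat \<Phi>2 (\<phi> y)"
    if "x \<in> \<Phi>1" "y \<in> \<Phi>1" "refl1 x = refl1 y" for x y
  proof -
    have x: "x = pair x (\<phi> y) *\<^sub>R y" "\<phi> x = pair y (\<phi> x) *\<^sub>R \<phi> y"
      using refl_eq_imp_multiple that unfolding \<Phi>1_def refl1_def by blast+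
    moreover have "x \<noteq> 0" "\<phi> x \<noteq> 0"
      using pair_root_self[of x] that(1) by (auto simp: \<Phi>1_def pair_simps)
    ultimately have "pair x (\<phi> y) \<noteq> 0" "pair y (\<phi> x) \<noteq> 0" by auto
    then show "hat \<Phi>1 x = hat \<Phi>1 y" "hat \<Phi>2 (\<phi> x) = hat \<Phi>2 (\<phi> y)"
      using x hat_scaleR by metis+
  qed
  have "hat \<Phi>1 ` \<Delta>1 = hat \<Phi>1 ` canonical_roots W S r act1 \<alpha> W'"
  proof
    have "\<Delta>1 \<subseteq> canonical_roots W S r act1 \<alpha> W'"
      using sub1 canonical by (auto simp: canonical_roots_def refl1_def)
    then show "hat \<Phi>1 ` \<Delta>1 \<subseteq> hat \<Phi>1 ` canonical_roots W S r act1 \<alpha> W'" by blast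
    show "hat \<Phi>1 ` canonical_roots W S r act1 \<alpha> W' \<subseteq> hat \<Phi>1 ` \<Delta>1"
    proof (rule image_subsetI)
      fix x assume "x \<in> canonical_roots W S r act1 \<alpha> W'"
      then have "x \<in> \<Phi>1" "refl1 x \<in> refl1 ` \<Delta>1"
        using canonical by (auto simp: canonical_roots_def positive_roots_def \<Phi>1_def refl1_def)
      then show "hat \<Phi>1 x \<in> hat \<Phi>1 ` \<Delta>1" using hat1 D1(1) by blast
    qed
  qed
  moreover have "hat \<Phi>2 ` \<Delta>2 = hat \<Phi>2 ` canonical_roots W S r act2 \<beta> W'"
  proof
    have "\<Delta>2 \<subseteq> canonical_roots W S r act2 \<beta> W'"
    proof
      fix y assume y: "y \<in> \<Delta>2"
      then obtain x where x: "x \<in> \<Delta>1" "y = \<phi> x" using A1 by blast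
      then have "root_reflection W S r act2 \<beta> y = refl1 x"
        using refl_phi D1(1) unfolding \<Phi>1_def refl1_def by blast
      then show "y \<in> canonical_roots W S r act2 \<beta> W'"
        using y x(1) sub2 canonical by (auto simp: canonical_roots_def)
    qed
    then show "hat \<Phi>2 ` \<Delta>2 \<subseteq> hat \<Phi>2 ` canonical_roots W S r act2 \<beta> W'" by blast
    show "hat \<Phi>2 ` canonical_roots W S r act2 \<beta> W' \<subseteq> hat \<Phi>2 ` \<Delta>2"
    proof (rule image_subsetI)
      fix y assume y: "y \<in> canonical_roots W S r act2 \<beta> W'"
      \<comment> \<open>Surjectivity of \<open>\<phi>\<close> lets the comparison be made in the
        first root system.\<close>
      then have "y \<in> \<phi> ` \<Phi>1"
        using phi_bij by (simp add: canonical_roots_def positive_roots_def \<Phi>1_def bij_betw_def)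
      then obtain x where x: "x \<in> \<Phi>1" "y = \<phi> x" by blast
      then have "refl1 x \<in> refl1 ` \<Delta>1"
        using y canonical refl_phi[of x] by (auto simp: canonical_roots_def \<Phi>1_def refl1_def)
      then obtain x' where "x' \<in> \<Delta>1" "refl1 x = refl1 x'" by blast
      then have "hat \<Phi>2 y = hat \<Phi>2 (\<phi> x')" using x hat2 D1(1) by blast
      then show "hat \<Phi>2 y \<in> hat \<Phi>2 ` \<Delta>2" using \<open>x' \<in> \<Delta>1\<close> A1 by blast
    qed
  qed
  ultimately show ?thesis
    using reflection_subgroup by (simp add: W'_def Let_def)
qed

end
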